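(* Let $\sigma>1$, $p\in\mathbf R\setminus\{0,1\}$, $\frac1p+\frac1q=1$, and put $\varphi(x):=x^{p(1-\sigma)-1}$, $\psi(y):=y^{q(1+\sigma)-1}$ $(x,y>0)$. Let $f,g\ge0$ be measurable functions on $(0,\infty)$ with $0<\|f\|_{p,\varphi}<\infty$ and $0<\|g\|_{q,\psi}<\infty$. (a) If $p>1$, then the following two inequalities hold and are equivalent, the constant factor $\frac{\Gamma(\sigma)}{2^{\sigma-1}}\zeta(\sigma)$ being the best possible in each: $$\int_0^\infty\int_0^\infty\left(\coth\frac xy-1\right)f(x)g(y)\,dx\,dy<\frac{\Gamma(\sigma)}{2^{\sigma-1}}\zeta(\sigma)\|f\|_{p,\varphi}\|g\|_{q,\psi},\qquad (A)$$ $$\left\{\int_0^\infty y^{-p\sigma-1}\left[\int_0^\infty\left(\coth\frac xy-1\right)f(x)\,dx\right]^pdy\right\}^{\frac1p}<\frac{\Gamma(\sigma)}{2^{\sigma-1}}\zeta(\sigma)\|f\|_{p,\varphi}.\qquad (B)$$ If $0<p<1$ or $p<0$, then the reverses of (A) and (B) (with $>$ in place of $<$) hold and are equivalent, with the same best possible constant factor. (b) Suppose moreover that $0<\|f\|:=\int_0^\infty f(x)\,dx<\infty$ and $0<\|g\|:=\int_0^\infty g(y)\,dy<\infty$. If $p>1$, then the following two inequalities hold and are equivalent, the constant factor $\frac{\Gamma(\sigma)}{2^{\sigma-1}}\zeta(\sigma)$ being the best possible in each: $$\int_0^\infty\int_0^\infty\coth\frac xy\,f(x)g(y)\,dx\,dy<\|f\|\,\|g\|+\frac{\Gamma(\sigma)}{2^{\sigma-1}}\zeta(\sigma)\|f\|_{p,\varphi}\|g\|_{q,\psi},\qquad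 (C)$$ $$\left\{\int_0^\infty y^{-p\sigma-1}\left[\int_0^\infty\coth\frac xy\,f(x)\,dx-\|f\|\right]^pdy\right\}^{\frac1p}<\frac{\Gamma(\sigma)}{2^{\sigma-1}}\zeta(\sigma)\|f\|_{p,\varphi}.\qquad (D)$$ If $0<p<1$ or $p<0$, then the reverses of (C) and (D) (with $>$ in place of $<$) hold and are equivalent, with the same best possible constant factor.
   Context: $\|f\|_{p,\varphi}:=\left\{\int_0^\infty\varphi(x)f^p(x)\,dx\right\}^{1/p}$ and $\|g\|_{q,\psi}:=\left\{\int_0^\infty\psi(y)g^q(y)\,dy\right\}^{1/q}$ (used formally also for exponents less than $1$). $\coth u=\frac{e^u+e^{-u}}{e^u-e^{-u}}$; $\Gamma$ is the Gamma function and $\zeta(\sigma)=\sum_{k\ge1}k^{-\sigma}$ the Riemann zeta function. "Best possible" means that, for the given parameters, the inequality for all admissible functions fails if the constant factor is replaced by a smaller one (in the reverse inequalities: by a larger one). "Equivalent" means that the first inequality (for all admissible $f,g$) and the second (for all admissible $f$) imply one another. Integrals of nonnegative functions take values in $[0,\infty]$; for negative exponents $r$, $0^r=+\infty$ and $(+\infty)^r=0$.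
   Formalization: In (b), "best possible" for the reverse of (C), and for the reverse of (D) when p<0, is asserted only if admissible functions exist; none do (a negative exponent's finite weighted norm excludes integrability), so those reverses are vacuous and the original sharpness claim there is false. *)

theory Defs
  imports "HOL-Analysis.Analysis"
begin

definition coth :: "real \<Rightarrow> real" where
  "coth u = (exp u + exp (- u)) / (exp u - exp (- u))"

definition zeta :: "real \<Rightarrow> real" where
  "zeta s = (\<Sum>k. 1 / real (Suc k) powr s)"

text \<open>Real powers on \<open>[0,\<infinity>]\<close>. For \<open>r < 0\<close> the conventions are
  \<open>0^r = \<infinity>\<close> and \<open>\<infinity>^r = 0\<close>, which is not what \<^const>\<open>powr\<close> on the reals
  does at \<open>0\<close>.\<close>

definition epow :: "ennreal \<Rightarrow> real \<Rightarrow> ennreal" where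
  "epow a r =
     (if a = 0 then (if r > 0 then 0 else if r = 0 then 1 else \<infinity>)
      else if a = \<infinity> then (if r > 0 then \<infinity> else if r = 0 then 1 else 0)
      else ennreal (enn2real a powr r))"

abbreviation Rpos :: "real measure" where
  "Rpos \<equiv> lebesgue_on {0<..}"

definition wnorm :: "real \<Rightarrow> (real \<Rightarrow> real) \<Rightarrow> (real \<Rightarrow> real) \<Rightarrow> ennreal" where
  "wnorm r w f = epow (\<integral>\<^sup>+x. ennreal (w x) * epow (ennreal (f x)) r \<partial>Rpos) (1 / r)"

definition l1norm :: "(real \<Rightarrow> real) \<Rightarrow> ennreal" where
  "l1norm f = (\<integral>\<^sup>+x. ennreal (f x) \<partial>Rpos)"

definition phi :: "real \<Rightarrow> real \<Rightarrow> real \<Rightarrow> real" where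
  "phi p \<sigma> x = x powr (p * (1 - \<sigma>) - 1)"

definition psi :: "real \<Rightarrow> real \<Rightarrow> real \<Rightarrow> real" where
  "psi q \<sigma> y = y powr (q * (1 + \<sigma>) - 1)"

definition adm :: "real \<Rightarrow> (real \<Rightarrow> real) \<Rightarrow> (real \<Rightarrow> real) set" where
  "adm r w = {f. f \<in> borel_measurable Rpos \<and> (\<forall>x>0. 0 \<le> f x) \<and>
                 0 < wnorm r w f \<and> wnorm r w f < \<infinity>}"

definition adm1 :: "real \<Rightarrow> (real \<Rightarrow> real) \<Rightarrow> (real \<Rightarrow> real) set" where
  "adm1 r w = {f \<in> adm r w. 0 < l1norm f \<and> l1norm f < \<infinity>}"

definition K_const :: "real \<Rightarrow> real" where
  "K_const \<sigma> = Gamma \<sigma> / 2 powr (\<sigma> - 1) * zeta \<sigma>"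

text \<open>Each of the following says that an inequality with constant factor \<open>c\<close> holds
  for all admissible functions; \<open>R\<close> is \<open>(<)\<close> for the direct inequality and
  \<open>(>)\<close> for its reverse. The subtraction in \<open>ineq_D\<close> is never truncated,
  because \<open>coth u > 1\<close> for \<open>u > 0\<close>.\<close>

definition ineq_A ::
  "(ennreal \<Rightarrow> ennreal \<Rightarrow> bool) \<Rightarrow> real \<Rightarrow> real \<Rightarrow> real \<Rightarrow> real \<Rightarrow> bool" where
  "ineq_A R p q \<sigma> c \<longleftrightarrow>
     (\<forall>f \<in> adm p (phi p \<sigma>). \<forall>g \<in> adm q (psi q \<sigma>).
        R (\<integral>\<^sup>+y. (\<integral>\<^sup>+x. ennreal ((coth (x / y) - 1) * f x * g y) \<partial>Rpos) \<partial>Rpos)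
          (ennreal c * wnorm p (phi p \<sigma>) f * wnorm q (psi q \<sigma>) g))"

definition ineq_B ::
  "(ennreal \<Rightarrow> ennreal \<Rightarrow> bool) \<Rightarrow> real \<Rightarrow> real \<Rightarrow> real \<Rightarrow> bool" where
  "ineq_B R p \<sigma> c \<longleftrightarrow>
     (\<forall>f \<in> adm p (phi p \<sigma>).
        R (epow (\<integral>\<^sup>+y. ennreal (y powr (- p * \<sigma> - 1)) *
                   epow (\<integral>\<^sup>+x. ennreal ((coth (x / y) - 1) * f x) \<partial>Rpos) p \<partial>Rpos) (1 / p))
          (ennreal c * wnorm p (phi p \<sigma>) f))"

definition ineq_C ::
  "(ennreal \<Rightarrow> ennreal \<Rightarrow> bool) \<Rightarrow> real \<Rightarrow> real \<Rightarrow> real \<Rightarrow> real \<Rightarrow> bool" where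
  "ineq_C R p q \<sigma> c \<longleftrightarrow>
     (\<forall>f \<in> adm1 p (phi p \<sigma>). \<forall>g \<in> adm1 q (psi q \<sigma>).
        R (\<integral>\<^sup>+y. (\<integral>\<^sup>+x. ennreal (coth (x / y) * f x * g y) \<partial>Rpos) \<partial>Rpos)
          (l1norm f * l1norm g + ennreal c * wnorm p (phi p \<sigma>) f * wnorm q (psi q \<sigma>) g))"

definition ineq_D ::
  "(ennreal \<Rightarrow> ennreal \<Rightarrow> bool) \<Rightarrow> real \<Rightarrow> real \<Rightarrow> real \<Rightarrow> bool" where
  "ineq_D R p \<sigma> c \<longleftrightarrow>
     (\<forall>f \<in> adm1 p (phi p \<sigma>).
        R (epow (\<integral>\<^sup>+y. ennreal (y powr (- p * \<sigma> - 1)) *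
                   epow ((\<integral>\<^sup>+x. ennreal (coth (x / y) * f x) \<partial>Rpos) - l1norm f) p \<partial>Rpos) (1 / p))
          (ennreal c * wnorm p (phi p \<sigma>) f))"

text \<open>With a negative exponent, finiteness of the weighted norm forces the function to
  be so large near \<open>0\<close> (weight \<open>psi\<close>) or near \<open>\<infinity>\<close> (weight \<open>phi\<close>) that it is not
  integrable. So no admissible pair exists for the reverse of \<open>ineq_C\<close> (one of \<open>p\<close>,
  \<open>q\<close> is negative), nor any admissible \<open>f\<close> for the reverse of \<open>ineq_D\<close> with
  \<open>p < 0\<close>. In these cases the inequality is vacuous for every constant, and
  sharpness of the constant can only be asserted subject to the existence of
  admissible functions.\<close>

lemma nn_integral_inverse_Icc:
  assumes "0 < a" "a \<le> b"
  shows "(\<integral>\<^sup>+x. ennreal (1 / x) * indicator {a..b} x \<partial>Rpos) = ennreal (ln b - ln a)"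
proof -
  have "(\<integral>\<^sup>+x. ennreal (1 / x) * indicator {a..b} x \<partial>Rpos)
      = (\<integral>\<^sup>+x. ennreal (1 / x) * indicator {a..b} x * indicator {0<..} x \<partial>lebesgue)"
    by (subst nn_integral_restrict_space) auto
  also have "\<dots> = (\<integral>\<^sup>+x. ennreal (1 / x) * indicator {a..b} x \<partial>lebesgue)"
    using assms by (intro nn_integral_cong) (auto split: split_indicator)
  also have "\<dots> = (\<integral>\<^sup>+x. ennreal (1 / x) * indicator {a..b} x \<partial>lborel)"
    by (rule nn_integral_completion)
  also have "\<dots> = ennreal (ln b - ln a)"
    using assms by (intro nn_integral_FTC_Icc) (auto intro!: derivative_eq_intros)
  finally show ?thesis .
qed

lemma epow_measurable [measurable]:
  assumes "F \<in> borel_measurable M"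
  shows "(\<lambda>x. epow (F x) r) \<in> borel_measurable M"
proof -
  have "(\<lambda>x. if F x = 0 then c else if F x = \<infinity> then d else ennreal (enn2real (F x) powr r))
      \<in> borel_measurable M" for c d :: ennreal
  proof (intro measurable_If)
    show "{x \<in> space M. F x = 0} \<in> sets M" "{x \<in> space M. F x = \<infinity>} \<in> sets M"
      using assms by (simp_all add: borel_measurable_eq)
    show "(\<lambda>x. ennreal (enn2real (F x) powr r)) \<in> borel_measurable M"
      using assms
      by (intro measurable_compose[OF _ measurable_ennreal] powr_real_measurable
          borel_measurable_enn2real borel_measurable_const)
  qed simp_all
  then show ?thesis unfolding epow_def .
qed

lemma not_integrable_of_large:
  assumes f: "f \<in> borel_measurable Rpos" and w: "w \<in> borel_measurable Rpos"
    and ab: "\<And>n::nat. 0 < a n \<and> a n \<le> b n \<and> ln (b n) - ln (a n) = real n"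
    and large: "\<And>n x. a n \<le> x \<Longrightarrow> x \<le> b n \<Longrightarrow>
        ennreal (1 / x) \<le> ennreal (f x) + ennreal (w x) * epow (ennreal (f x)) r"
    and fin: "l1norm f < \<infinity>" "0 < wnorm r w f" and r: "r < 0"
  shows False
proof -
  let ?I = "\<integral>\<^sup>+x. ennreal (w x) * epow (ennreal (f x)) r \<partial>Rpos"
  have "1 / r < 0" using r by simp
  then have "epow \<infinity> (1 / r) = 0" by (simp add: epow_def)
  then have I: "?I \<noteq> \<infinity>"
    using fin(2) unfolding wnorm_def by (intro notI) simp
  have bound: "ennreal (real n) \<le> l1norm f + ?I" for n
  proof -
    have "ennreal (real n) = (\<integral>\<^sup>+x. ennreal (1 / x) * indicator {a n..b n} x \<partial>Rpos)"
      using ab[of n] by (subst nn_integral_inverse_Icc) auto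
    also have "\<dots> \<le> (\<integral>\<^sup>+x. ennreal (f x) + ennreal (w x) * epow (ennreal (f x)) r \<partial>Rpos)"
      using large[of n] by (intro nn_integral_mono) (auto split: split_indicator)
    also have "\<dots> = l1norm f + ?I"
      unfolding l1norm_def using f w by (intro nn_integral_add) auto
    finally show ?thesis .
  qed
  have "l1norm f + ?I < top"
    using fin(1) I by (simp add: top.not_eq_extremum)
  then obtain n :: nat where "l1norm f + ?I < of_nat n"
    using ennreal_Ex_less_of_nat by blast
  then show False
    using bound[of n] by (simp add: ennreal_of_nat_eq_real_of_nat leD)
qed

lemma large_aux:
  assumes "r < 0" "0 < x" "0 \<le> t" "x powr r \<le> x * w"
  shows "ennreal (1 / x) \<le> ennreal t + ennreal w * epow (ennreal t) r"
proof (cases "1 / x \<le> t")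
  case True
  then have "ennreal (1 / x) \<le> ennreal t" by (simp add: ennreal_leI)
  then show ?thesis by (simp add: add_increasing2)
next
  case False
  have w: "0 < w" 
  proof -
    have "0 < x * w" using assms(2,4) by (intro less_le_trans[of 0 "x powr r" "x * w"]) auto
    then show ?thesis using assms(2) by (simp add: zero_less_mult_iff)
  qed
  have "ennreal (1 / x) \<le> ennreal w * epow (ennreal t) r"
  proof (cases "t = 0")
    case True
    then show ?thesis using assms w by (simp add: epow_def ennreal_mult_top)
  next
    case t: False
    then have t0: "0 < t" using assms by simp
    have "1 / x \<le> w * x powr (- r)"
      using assms(2,4) by (simp add: powr_minus divide_simps mult.commute)
    also have "x powr (- r) = (1 / x) powr r"
      using assms(2) by (simp add: powr_divide powr_minus_divide)
    also have "w * (1 / x) powr r \<le> w * t powr r"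
      using False t0 w assms(1) by (intro mult_left_mono powr_mono2') auto
    finally have "ennreal (1 / x) \<le> ennreal (w * t powr r)" by (rule ennreal_leI)
    also have "\<dots> = ennreal w * epow (ennreal t) r"
      using t0 w by (simp add: epow_def ennreal_mult)
    finally show ?thesis .
  qed
  then show ?thesis by (simp add: add_increasing)
qed

lemma adm1_psi_empty:
  assumes "\<sigma> > 1" "q < 0"
  shows "adm1 q (psi q \<sigma>) = {}"
proof (rule ccontr)
  assume "adm1 q (psi q \<sigma>) \<noteq> {}"
  then obtain g where g: "g \<in> adm1 q (psi q \<sigma>)" by blast
  have w: "psi q \<sigma> \<in> borel_measurable Rpos"
    unfolding psi_def by (intro measurable_restrict_space1 measurable_completion) measurable
  have *: "ennreal (1 / x) \<le> ennreal (g x) + ennreal (psi q \<sigma> x) * epow (ennreal (g x)) q"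
    if x: "exp (- real n) \<le> x" "x \<le> 1" for n :: nat and x :: real
  proof -
    have x0: "0 < x" using x(1) exp_gt_zero by (rule less_le_trans[rotated])
    have "x * psi q \<sigma> x = x powr (q * (1 + \<sigma>))"
      unfolding psi_def using x0 by (simp add: powr_diff)
    moreover have "x powr q \<le> x powr (q * (1 + \<sigma>))"
      using x0 x(2) assms by (intro powr_mono') (auto simp: algebra_simps mult_nonneg_nonpos)
    ultimately show ?thesis
      using g x0 assms by (intro large_aux) (auto simp: adm1_def adm_def)
  qed
  show False
    by (rule not_integrable_of_large[of g "psi q \<sigma>" "\<lambda>n. exp (- real n)" "\<lambda>_. 1" q])
      (use g w * assms in \<open>auto simp: adm1_def adm_def\<close>)
qed

lemma adm1_phi_empty:
  assumes "\<sigma> > 1" "p < 0"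
  shows "adm1 p (phi p \<sigma>) = {}"
proof (rule ccontr)
  assume "adm1 p (phi p \<sigma>) \<noteq> {}"
  then obtain f where f: "f \<in> adm1 p (phi p \<sigma>)" by blast
  have w: "phi p \<sigma> \<in> borel_measurable Rpos"
    unfolding phi_def by (intro measurable_restrict_space1 measurable_completion) measurable
  have *: "ennreal (1 / x) \<le> ennreal (f x) + ennreal (phi p \<sigma> x) * epow (ennreal (f x)) p"
    if x: "1 \<le> x" "x \<le> exp (real n)" for n :: nat and x :: real
  proof -
    have "x * phi p \<sigma> x = x powr (p * (1 - \<sigma>))"
      unfolding phi_def using x(1) by (simp add: powr_diff)
    moreover have "x powr p \<le> x powr (p * (1 - \<sigma>))"
      using x(1) assms by (intro powr_mono) (auto simp: algebra_simps mult_nonneg_nonpos)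
    ultimately show ?thesis
      using f x(1) assms by (intro large_aux) (auto simp: adm1_def adm_def)
  qed
  show False
    by (rule not_integrable_of_large[of f "phi p \<sigma>" "\<lambda>_. 1" "\<lambda>n. exp (real n)" p])
      (use f w * assms in \<open>auto simp: adm1_def adm_def\<close>)
qed

end

theory Submission
  imports Defs
begin

text \<open>
  On the multiplicative group \<open>(0,\<infinity>)\<close> with Haar measure \<open>dx/x\<close> put
  \<open>F x = x powr (1 - \<sigma>) * f x\<close> and \<open>G y = y powr (1 + \<sigma>) * g y\<close>. Then the two weighted norms
  become the plain norms \<open>\<parallel>F\<parallel>\<^sub>p\<close> and \<open>\<parallel>G\<parallel>\<^sub>q\<close>, and \<open>\<integral> (coth (x/y) - 1) f x dx\<close> becomes
  \<open>y powr \<sigma>\<close> times \<open>T F y = \<integral> kern (x/y) F x dx/x\<close> with \<open>kern u = (coth u - 1) u powr \<sigma>\<close>.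
  So \<^const>\<open>ineq_B\<close> compares \<open>\<parallel>T F\<parallel>\<^sub>p\<close> with \<open>K \<parallel>F\<parallel>\<^sub>p\<close>, and \<^const>\<open>ineq_A\<close> compares \<open>\<integral> T F \<cdot> G\<close> with
  \<open>K \<parallel>F\<parallel>\<^sub>p \<parallel>G\<parallel>\<^sub>q\<close>. Expanding \<open>coth u - 1 = 2 (exp (-2u) + exp (-4u) + \<dots>)\<close> and integrating each
  term by the Gamma integral gives \<open>\<integral> kern u du/u = K\<close> (\<open>nn_integral_kern\<close>), where \<open>K\<close> is
  \<^term>\<open>K_const \<sigma>\<close>.

  After division by \<open>K\<close>, \<open>T\<close> averages against a kernel both of whose marginals are \<open>1\<close>. Jensen's
  inequality for \<open>t powr p\<close> at each \<open>y\<close>, integrated over \<open>y\<close>, gives the comparison of norms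
  (\<open>markov_norm_less\<close>, \<open>markov_norm_greater\<close>). It is strict, since equality would force \<open>F\<close> to be
  constant almost everywhere, and a constant does not have a positive finite norm on a space of
  infinite measure. The bilinear inequality follows by Young's inequality, direct or reversed
  (\<open>holder_normalised\<close>). Because \<open>coth = 1 + (coth - 1)\<close>, \<^const>\<open>ineq_C\<close> and \<^const>\<open>ineq_D\<close> are
  \<^const>\<open>ineq_A\<close> and \<^const>\<open>ineq_B\<close> restricted to integrable functions. Two inequalities that both
  hold are equivalent.

  Sharpness for \<open>p > 1\<close> is tested on the indicator of a long interval \<open>[exp (-n), exp n]\<close>, on most of
  which \<open>T\<close> multiplies by nearly \<open>K\<close>; the corresponding \<open>f\<close> and \<open>g\<close> are integrable, so all four
  inequalities are covered. For \<open>p < 1\<close> it is tested on \<open>F x = exp (-(\<epsilon>/p) \<bar>ln x\<bar>)\<close> and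
  \<open>G y = exp (-(\<epsilon>/q) \<bar>ln y\<bar>)\<close>. There \<open>T F \<le> K' F\<close> pointwise, with
  \<open>K' = \<integral> kern u * exp (\<delta> \<bar>ln u\<bar>) du/u\<close> and \<open>\<delta> = \<epsilon>/\<bar>p\<bar>\<close>, and \<open>K'\<close> tends to \<open>K\<close> as \<open>\<delta>\<close> tends to
  \<open>0\<close>. For the reverse of \<^const>\<open>ineq_D\<close> with \<open>0 < p < 1\<close> this \<open>F\<close> is cut off at a large \<open>x\<close>, which
  makes \<open>f\<close> integrable and hardly changes the norm. In the other reverse cases of \<^const>\<open>ineq_C\<close>
  and \<^const>\<open>ineq_D\<close> one of the exponents is negative, and no function with a finite positive norm for that exponent
  is integrable.
\<close>

section \<open>Powers and mean inequalities on the extended half-line\<close>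

lemma ennreal_zero_pos_top_cases:
  obtains "a = 0" | "a = (top::ennreal)" | x where "0 < x" "a = ennreal x"
proof (cases a)
  case (real r)
  then show ?thesis using that by (cases "r = 0") auto
qed (use that in auto)

lemma epow_ennreal: "0 < x \<Longrightarrow> epow (ennreal x) r = ennreal (x powr r)"
  by (simp add: epow_def)

lemma epow_zero_pos [simp]: "r > 0 \<Longrightarrow> epow 0 r = 0"
  and epow_zero_neg [simp]: "r < 0 \<Longrightarrow> epow 0 r = top"
  and epow_top_pos [simp]: "r > 0 \<Longrightarrow> epow top r = top"
  and epow_top_neg [simp]: "r < 0 \<Longrightarrow> epow top r = 0"
  by (simp_all add: epow_def)

lemma epow_one: "epow a 1 = a"
  by (cases a rule: ennreal_zero_pos_top_cases) (auto simp: epow_ennreal)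

lemma epow_cmult:
  assumes "0 < c"
  shows "epow (ennreal c * a) r = ennreal (c powr r) * epow a r"
proof (cases a rule: ennreal_zero_pos_top_cases)
  case (3 x)
  with assms show ?thesis
    by (simp add: epow_ennreal powr_mult flip: ennreal_mult)
qed (use assms in \<open>auto simp: epow_def ennreal_mult_top\<close>)

lemma epow_epow:
  assumes "r \<noteq> 0" "s \<noteq> 0"
  shows "epow (epow a r) s = epow a (r * s)"
proof (cases a rule: ennreal_zero_pos_top_cases)
  case (3 x)
  then show ?thesis by (simp add: epow_ennreal powr_powr)
qed (use assms in \<open>auto simp: epow_def zero_less_mult_iff\<close>)

lemma epow_strict_mono:
  assumes "a < b" "r > 0" shows "epow a r < epow b r"
  by (cases a rule: ennreal_zero_pos_top_cases; cases b rule: ennreal_zero_pos_top_cases)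
    (use assms in \<open>auto simp: epow_ennreal ennreal_less_iff intro!: powr_less_mono2\<close>)

lemma epow_strict_antimono:
  assumes "a < b" "r < 0" shows "epow b r < epow a r"
  by (cases a rule: ennreal_zero_pos_top_cases; cases b rule: ennreal_zero_pos_top_cases)
    (use assms in \<open>auto simp: epow_ennreal ennreal_less_iff intro!: powr_less_mono2_neg\<close>)

lemma epow_mono: "a \<le> b \<Longrightarrow> r > 0 \<Longrightarrow> epow a r \<le> epow b r"
  using epow_strict_mono[of a b r] by (cases "a = b") (auto simp: order_less_le)

lemma epow_antimono: "a \<le> b \<Longrightarrow> r < 0 \<Longrightarrow> epow b r \<le> epow a r"
  using epow_strict_antimono[of a b r] by (cases "a = b") (auto simp: order_less_le)

lemma epow_eq_0_iff: "r \<noteq> 0 \<Longrightarrow> epow a r = 0 \<longleftrightarrow> (if r > 0 then a = 0 else a = \<infinity>)"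
  by (cases a rule: ennreal_zero_pos_top_cases) (auto simp: epow_def)

lemma epow_eq_top_iff: "r \<noteq> 0 \<Longrightarrow> epow a r = \<infinity> \<longleftrightarrow> (if r > 0 then a = \<infinity> else a = 0)"
  by (cases a rule: ennreal_zero_pos_top_cases) (auto simp: epow_def)

lemma epow_pos_finite_iff:
  assumes "r \<noteq> 0" shows "0 < epow a r \<and> epow a r < \<infinity> \<longleftrightarrow> 0 < a \<and> a < \<infinity>"
  by (cases a rule: ennreal_zero_pos_top_cases) (use assms in \<open>auto simp: epow_def\<close>)

lemma weighted_am_gm_strict:
  fixes u v \<alpha> \<beta> :: real
  assumes "0 < \<alpha>" "0 < \<beta>" "\<alpha> + \<beta> = 1" "0 < u" "0 < v" "u \<noteq> v"
  shows "u powr \<alpha> * v powr \<beta> < \<alpha> * u + \<beta> * v"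
proof -
  define m where "m = \<alpha> * u + \<beta> * v"
  have m: "0 < m" using assms by (simp add: m_def add_pos_pos)
  have le: "ln (w / m) \<le> w / m - 1" "ln (w / m) = w / m - 1 \<Longrightarrow> w = m" if "0 < w" for w
  proof -
    show "ln (w / m) \<le> w / m - 1" using that m by (intro ln_le_minus_one) simp
    show "w = m" if "ln (w / m) = w / m - 1"
      using ln_eq_minus_one[of "w / m"] that \<open>0 < w\<close> m by simp
  qed
  have "u \<noteq> m \<or> v \<noteq> m" using assms by auto
  then have "\<alpha> * ln (u / m) + \<beta> * ln (v / m) < \<alpha> * (u / m - 1) + \<beta> * (v / m - 1)"
  proof
    assume "u \<noteq> m"
    then show ?thesis using le[of u] le[of v] assms
      by (intro add_less_le_mono mult_strict_left_mono mult_left_mono) (auto simp: order_less_le)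
  next
    assume "v \<noteq> m"
    then show ?thesis using le[of u] le[of v] assms
      by (intro add_le_less_mono mult_strict_left_mono mult_left_mono) (auto simp: order_less_le)
  qed
  also have "\<dots> = (\<alpha> * u + \<beta> * v) / m - (\<alpha> + \<beta>)"
    using m by (simp add: field_simps)
  also have "\<dots> = 0" using m assms(3) by (simp add: m_def)
  also have "\<alpha> * ln (u / m) + \<beta> * ln (v / m) = \<alpha> * ln u + \<beta> * ln v - (\<alpha> + \<beta>) * ln m"
    using assms(4,5) m by (simp add: ln_div algebra_simps)
  finally have "\<alpha> * ln u + \<beta> * ln v < ln m" unfolding assms(3) by simp
  then have "exp (\<alpha> * ln u + \<beta> * ln v) < exp (ln m)" by (simp only: exp_less_mono)
  then show ?thesis using assms m by (simp add: powr_def exp_add m_def)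
qed

lemma weighted_am_gm:
  fixes u v \<alpha> \<beta> :: real
  assumes "0 < \<alpha>" "0 < \<beta>" "\<alpha> + \<beta> = 1" "0 < u" "0 < v"
  shows "u powr \<alpha> * v powr \<beta> \<le> \<alpha> * u + \<beta> * v"
proof (cases "u = v")
  case True
  then show ?thesis using assms by (simp flip: powr_add distrib_right)
qed (use weighted_am_gm_strict[of \<alpha> \<beta> u v] assms in auto)

lemma powr_left_inj:
  fixes s t p :: real
  assumes "p \<noteq> 0" "0 < s" "0 < t" "t powr p = s powr p" shows "t = s"
  using assms by (simp add: powr_def)

text \<open>For \<open>p > 1\<close> and, below, for \<open>p < 0\<close>: away from \<open>s\<close> the graph of \<open>t powr p\<close> lies strictly above its
  tangent at \<open>s\<close>. The terms are
  arranged so that none is negative, which lets the inequality pass to \<^typ>\<open>ennreal\<close>.\<close>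

lemma powr_tangent_gt_1:
  fixes s t p :: real
  assumes "p > 1" "0 < s" "0 \<le> t" "t \<noteq> s"
  shows "p * s powr (p - 1) * t < t powr p + (p - 1) * s powr p"
proof (cases "t = 0")
  case False
  have ne: "t powr p \<noteq> s powr p" using assms False powr_left_inj[of p s t] by auto
  have "(t powr p) powr (1 / p) * (s powr p) powr (1 - 1 / p)
      < 1 / p * t powr p + (1 - 1 / p) * s powr p"
    using assms False ne by (intro weighted_am_gm_strict) auto
  moreover have "(t powr p) powr (1 / p) * (s powr p) powr (1 - 1 / p) = t * s powr (p - 1)"
    using assms by (simp add: powr_powr right_diff_distrib)
  ultimately have "p * (t * s powr (p - 1)) < p * (1 / p * t powr p + (1 - 1 / p) * s powr p)"
    using assms by simp
  then show ?thesis using assms by (simp add: algebra_simps)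
qed (use assms in auto)

lemma powr_tangent_neg:
  fixes s t p :: real
  assumes "p < 0" "0 < s" "0 < t" "t \<noteq> s"
  shows "(1 - p) * s powr p < t powr p + - p * s powr (p - 1) * t"
proof -
  have ne: "t powr p \<noteq> s powr (p - 1) * t"
  proof
    assume "t powr p = s powr (p - 1) * t"
    then have "t powr (p - 1) = s powr (p - 1)" using assms by (simp add: powr_diff)
    with assms powr_left_inj[of "p - 1" s t] show False by simp
  qed
  have "(t powr p) powr (1 / (1 - p)) * (s powr (p - 1) * t) powr (- p / (1 - p))
      < 1 / (1 - p) * t powr p + - p / (1 - p) * (s powr (p - 1) * t)"
    using assms ne by (intro weighted_am_gm_strict) (auto simp: field_simps)
  moreover have "(t powr p) powr (1 / (1 - p)) * (s powr (p - 1) * t) powr (- p / (1 - p)) = s powr p"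
  proof -
    have e: "(p - 1) * (- p / (1 - p)) = p" using assms by (simp add: field_simps)
    have "(t powr p) powr (1 / (1 - p)) * (s powr (p - 1) * t) powr (- p / (1 - p))
        = t powr (p / (1 - p) + - p / (1 - p)) * s powr ((p - 1) * (- p / (1 - p)))"
      using assms by (simp add: powr_mult powr_powr powr_add powr_minus)
    also have "\<dots> = s powr p" unfolding e using assms by simp
    finally show ?thesis .
  qed
  ultimately have "s powr p < (t powr p + - p * (s powr (p - 1) * t)) / (1 - p)"
    by (simp add: add_divide_distrib diff_divide_distrib)
  then show ?thesis using assms by (simp add: field_simps)
qed

lemma epow_young:
  assumes "p > 1" "1 / p + 1 / q = 1"
  shows "x * y \<le> ennreal (1 / p) * epow x p + ennreal (1 / q) * epow y q"
proof -
  have "1 / p < 1" using assms by simp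
  then have q: "0 < 1 / q" using assms by linarith
  then have q': "q > 0" by simp
  show ?thesis
  proof (cases x rule: ennreal_zero_pos_top_cases; cases y rule: ennreal_zero_pos_top_cases)
    fix a b assume *: "0 < a" "x = ennreal a" "0 < b" "y = ennreal b"
    have "(a powr p) powr (1 / p) * (b powr q) powr (1 / q) \<le> 1 / p * a powr p + 1 / q * b powr q"
      using * assms q by (intro weighted_am_gm) auto
    then have "a * b \<le> 1 / p * a powr p + 1 / q * b powr q"
      using * assms q' by (simp add: powr_powr)
    then have "ennreal (a * b) \<le> ennreal (1 / p * a powr p + 1 / q * b powr q)" by (rule ennreal_leI)
    then show ?thesis using * assms q'
      by (simp add: epow_ennreal flip: ennreal_mult ennreal_plus)
  qed (use assms q' in \<open>auto simp: ennreal_mult_top\<close>)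
qed

text \<open>For \<open>0 < p < 1\<close> the conjugate exponent \<open>q\<close> is negative; Young's inequality then bounds the
  \<open>p\<close>-th power.\<close>

lemma epow_young_reverse:
  assumes "0 < p" "p < 1" "1 / p + 1 / q = 1"
  shows "ennreal (1 / p) * epow x p \<le> x * y + ennreal (- 1 / q) * epow y q"
proof -
  have "1 < 1 / p" using assms by simp
  then have q: "1 / q < 0" using assms by linarith
  then have q': "q < 0" by simp
  show ?thesis
  proof (cases x rule: ennreal_zero_pos_top_cases; cases y rule: ennreal_zero_pos_top_cases)
    fix a b assume *: "0 < a" "x = ennreal a" "0 < b" "y = ennreal b"
    have pq: "p + - p / q = 1"
    proof -
      have "p * (1 / p + 1 / q) = p * 1" by (simp only: assms)
      then show ?thesis using assms(1,2) by (simp add: distrib_left)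
    qed
    \<comment> \<open>the factors of \<open>b\<close> cancel: the product is \<open>a powr p\<close>, with weights \<open>p\<close> and \<open>- p / q\<close>\<close>
    have "(a * b) powr p * (b powr q) powr (- p / q) \<le> p * (a * b) + - p / q * b powr q"
      using * assms q' pq by (intro weighted_am_gm) (auto simp: field_simps)
    also have "(a * b) powr p * (b powr q) powr (- p / q) = a powr p"
      using * assms q' by (simp add: powr_mult powr_powr flip: powr_add)
    finally have "1 / p * a powr p \<le> a * b + - 1 / q * b powr q"
      using assms by (simp add: field_simps)
    then have "ennreal (1 / p * a powr p) \<le> ennreal (a * b + - 1 / q * b powr q)" by (rule ennreal_leI)
    also have "\<dots> = ennreal (a * b) + ennreal (- 1 / q * b powr q)"
      using * q' by (intro ennreal_plus) (auto simp: divide_nonneg_neg mult_nonneg_nonneg divide_nonpos_neg)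
    also have "ennreal (1 / p * a powr p) = ennreal (1 / p) * epow x p"
      using * assms by (simp add: epow_ennreal flip: ennreal_mult)
    also have "ennreal (a * b) = x * y" using * by (simp add: ennreal_mult)
    also have "ennreal (- 1 / q * b powr q) = ennreal (- 1 / q) * ennreal (b powr q)"
      using q by (intro ennreal_mult) auto
    finally show ?thesis using * by (simp only: epow_ennreal)
  qed (use assms q' in \<open>auto simp: ennreal_mult_top ennreal_top_mult\<close>)
qed

section \<open>Strict Jensen inequality for powers\<close>

lemma epow_tangent_gt_1:
  assumes "p > 1" "0 < s"
  shows "ennreal (p * s powr (p - 1)) * t \<le> epow t p + ennreal ((p - 1) * s powr p)"
    and "t \<noteq> ennreal s \<Longrightarrow> t < top \<Longrightarrow>
      ennreal (p * s powr (p - 1)) * t < epow t p + ennreal ((p - 1) * s powr p)"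
proof -
  have strict: "ennreal (p * s powr (p - 1)) * t < epow t p + ennreal ((p - 1) * s powr p)"
    if ne: "t \<noteq> ennreal s" and fin: "t < top"
  proof (cases t rule: ennreal_zero_pos_top_cases)
    case (3 x)
    have "ennreal (p * s powr (p - 1) * x) < ennreal (x powr p + (p - 1) * s powr p)"
      using 3 ne assms powr_tangent_gt_1[of p s x] by (intro ennreal_lessI) (auto simp: add_nonneg_pos)
    then show ?thesis using 3 assms by (simp add: epow_ennreal ennreal_mult)
  qed (use assms fin in auto)
  show "ennreal (p * s powr (p - 1)) * t \<le> epow t p + ennreal ((p - 1) * s powr p)"
  proof (cases "t = ennreal s")
    case True
    have "ennreal (p * s powr (p - 1) * s) = ennreal (s powr p + (p - 1) * s powr p)"
      using assms by (simp add: powr_diff algebra_simps)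
    with True assms show ?thesis by (simp add: epow_ennreal ennreal_mult)
  next
    case False
    show ?thesis
    proof (cases "t = top")
      case True
      then show ?thesis using assms by simp
    next
      case fin: False
      show ?thesis using strict[OF False] fin by (simp add: less_top less_imp_le)
    qed
  qed
  show "t \<noteq> ennreal s \<Longrightarrow> t < top \<Longrightarrow>
      ennreal (p * s powr (p - 1)) * t < epow t p + ennreal ((p - 1) * s powr p)"
    by (rule strict)
qed

lemma epow_tangent_neg:
  assumes "p < 0" "0 < s"
  shows "ennreal ((1 - p) * s powr p) \<le> epow t p + ennreal (- p * s powr (p - 1)) * t"
    and "t \<noteq> ennreal s \<Longrightarrow> ennreal ((1 - p) * s powr p) < epow t p + ennreal (- p * s powr (p - 1)) * t"
proof -
  have strict: "ennreal ((1 - p) * s powr p) < epow t p + ennreal (- p * s powr (p - 1)) * t"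
    if ne: "t \<noteq> ennreal s"
  proof (cases t rule: ennreal_zero_pos_top_cases)
    case (3 x)
    have "ennreal ((1 - p) * s powr p) < ennreal (x powr p + - p * s powr (p - 1) * x)"
      using 3 ne assms powr_tangent_neg[of p s x] by (subst ennreal_less_iff) auto
    also have "\<dots> = ennreal (x powr p) + ennreal (- p * s powr (p - 1) * x)"
      using 3 assms by (intro ennreal_plus) (auto simp: mult_nonpos_nonneg)
    also have "ennreal (- p * s powr (p - 1) * x) = ennreal (- p * s powr (p - 1)) * ennreal x"
      using 3 assms by (intro ennreal_mult) (auto simp: mult_nonpos_nonneg)
    finally show ?thesis using 3 by (simp add: epow_ennreal)
  next
    case 1
    then show ?thesis using assms by simp
  next
    case 2
    have "0 < - p * s powr (p - 1)" using assms by (intro mult_pos_pos) auto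
    then show ?thesis using 2 assms by (simp add: ennreal_mult_top)
  qed
  show "ennreal ((1 - p) * s powr p) \<le> epow t p + ennreal (- p * s powr (p - 1)) * t"
  proof (cases "t = ennreal s")
    case True
    have "ennreal ((1 - p) * s powr p) = ennreal (s powr p + - p * s powr (p - 1) * s)"
      using assms by (simp add: powr_diff algebra_simps)
    also have "\<dots> = ennreal (s powr p) + ennreal (- p * s powr (p - 1) * s)"
      using assms by (intro ennreal_plus) (auto simp: mult_nonpos_nonneg)
    also have "ennreal (- p * s powr (p - 1) * s) = ennreal (- p * s powr (p - 1)) * ennreal s"
      using assms by (intro ennreal_mult) (auto simp: mult_nonpos_nonneg)
    finally show ?thesis using True assms by (simp add: epow_ennreal)
  qed (rule less_imp_le[OF strict])
  show "t \<noteq> ennreal s \<Longrightarrow> ennreal ((1 - p) * s powr p) < epow t p + ennreal (- p * s powr (p - 1)) * t"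
    by (rule strict)
qed

text \<open>Jensen's inequality for a probability measure, by integrating the tangent inequality at
  \<open>s = \<integral> F\<close>. In the strict version finiteness of one side suffices, as finiteness of the other
  side alone already makes the inequality strict.\<close>

lemma jensen_epow_gt_1:
  assumes emeasure_space_1: "emeasure M (space M) = 1"
    and [measurable]: "F \<in> borel_measurable M" and p: "p > 1"
  shows "epow (\<integral>\<^sup>+x. F x \<partial>M) p \<le> (\<integral>\<^sup>+x. epow (F x) p \<partial>M)"
    and "\<not> (\<exists>c. AE x in M. F x = c) \<Longrightarrow>
      epow (\<integral>\<^sup>+x. F x \<partial>M) p < top \<or> (\<integral>\<^sup>+x. epow (F x) p \<partial>M) < top \<Longrightarrow>
      epow (\<integral>\<^sup>+x. F x \<partial>M) p < (\<integral>\<^sup>+x. epow (F x) p \<partial>M)"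
proof -
  let ?A = "\<integral>\<^sup>+x. epow (F x) p \<partial>M"
  have "epow (\<integral>\<^sup>+x. F x \<partial>M) p \<le> ?A \<and> (\<not> (\<exists>c. AE x in M. F x = c) \<longrightarrow>
      epow (\<integral>\<^sup>+x. F x \<partial>M) p < top \<or> ?A < top \<longrightarrow> epow (\<integral>\<^sup>+x. F x \<partial>M) p < ?A)"
  proof (cases "\<integral>\<^sup>+x. F x \<partial>M" rule: ennreal_zero_pos_top_cases)
    case 1
    have "?A \<noteq> 0" if "\<not> (\<exists>c. AE x in M. F x = c)"
      using that p by (auto simp: nn_integral_0_iff_AE epow_eq_0_iff)
    with 1 p show ?thesis by (auto simp: zero_less_iff_neq_zero)
  next
    case 2
    \<comment> \<open>an infinite mean forces the integral of the powers to be infinite\<close>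
    have "(\<integral>\<^sup>+x. F x \<partial>M) \<le> (\<integral>\<^sup>+x. epow (F x) p + 1 \<partial>M)"
    proof (rule nn_integral_mono)
      fix x
      show "F x \<le> epow (F x) p + 1"
      proof (cases "F x \<le> 1")
        case True then show ?thesis by (simp add: add_increasing)
      next
        case False
        then have "F x \<le> epow (F x) p"
        proof (cases "F x" rule: ennreal_zero_pos_top_cases)
          case (3 t)
          with False have "1 < t" by (simp add: ennreal_le_1)
          then have "t powr 1 \<le> t powr p" using p by (intro powr_mono) auto
          with 3 show ?thesis by (simp add: epow_ennreal ennreal_leI)
        qed (use p in auto)
        then show ?thesis by (simp add: add_increasing2)
      qed
    qed
    also have "\<dots> = ?A + 1" by (simp add: nn_integral_add emeasure_space_1)
    finally have "?A = top" using 2 by (simp add: top_unique)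
    with 2 p show ?thesis by simp
  next
    case (3 s)
    let ?c = "p * s powr (p - 1)" and ?d = "(p - 1) * s powr p"
    have S: "epow (\<integral>\<^sup>+x. F x \<partial>M) p = ennreal (s powr p)" using 3 by (simp add: epow_ennreal)
    have L: "(\<integral>\<^sup>+x. ennreal ?c * F x \<partial>M) = ennreal (s powr p + ?d)"
    proof -
      have "(\<integral>\<^sup>+x. ennreal ?c * F x \<partial>M) = ennreal ?c * ennreal s"
        using 3 by (simp add: nn_integral_cmult)
      also have "\<dots> = ennreal (?c * s)" using 3 p by (intro ennreal_mult[symmetric]) auto
      also have "?c * s = s powr p + ?d" using 3 by (simp add: powr_diff algebra_simps)
      finally show ?thesis .
    qed
    have R: "(\<integral>\<^sup>+x. epow (F x) p + ennreal ?d \<partial>M) = ?A + ennreal ?d"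
      by (simp add: nn_integral_add emeasure_space_1)
    show ?thesis
    proof (cases ?A)
      case top
      with S show ?thesis by simp
    next
      case (real a)
      have R': "?A + ennreal ?d = ennreal (a + ?d)"
        unfolding real(2) using real p by (intro ennreal_plus[symmetric]) auto
      have "(\<integral>\<^sup>+x. ennreal ?c * F x \<partial>M) \<le> (\<integral>\<^sup>+x. epow (F x) p + ennreal ?d \<partial>M)"
        by (intro nn_integral_mono epow_tangent_gt_1(1)[OF p \<open>0 < s\<close>])
      then have "ennreal (s powr p + ?d) \<le> ennreal (a + ?d)" unfolding L R R' .
      then have le: "s powr p \<le> a"
        using real p by (subst (asm) ennreal_le_iff) auto
      have "s powr p < a" if nc: "\<not> (\<exists>c. AE x in M. F x = c)"
      proof -
        have fin: "AE x in M. F x < top"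
          using nn_integral_PInf_AE[of F M] 3 by (simp add: less_top)
        have "(\<integral>\<^sup>+x. ennreal ?c * F x \<partial>M) < (\<integral>\<^sup>+x. epow (F x) p + ennreal ?d \<partial>M)"
        proof (rule nn_integral_less)
          show "\<not> (AE x in M. epow (F x) p + ennreal ?d \<le> ennreal ?c * F x)"
          proof
            assume "AE x in M. epow (F x) p + ennreal ?d \<le> ennreal ?c * F x"
            with fin have "AE x in M. F x = ennreal s"
              by eventually_elim (metis epow_tangent_gt_1(2)[OF p \<open>0 < s\<close>] not_le)
            with nc show False by blast
          qed
          show "AE x in M. ennreal ?c * F x \<le> epow (F x) p + ennreal ?d"
            by (intro AE_I2 epow_tangent_gt_1(1)[OF p \<open>0 < s\<close>])
          show "(\<integral>\<^sup>+x. ennreal ?c * F x \<partial>M) \<noteq> \<infinity>" unfolding L by simp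
        qed auto
        then have "ennreal (s powr p + ?d) < ennreal (a + ?d)" unfolding L R R' .
        then show ?thesis using 3 p by (subst (asm) ennreal_less_iff) auto
      qed
      with le show ?thesis unfolding S real(2) by (auto simp: ennreal_less_iff ennreal_leI)
    qed
  qed
  then show "epow (\<integral>\<^sup>+x. F x \<partial>M) p \<le> (\<integral>\<^sup>+x. epow (F x) p \<partial>M)"
    and "\<not> (\<exists>c. AE x in M. F x = c) \<Longrightarrow>
      epow (\<integral>\<^sup>+x. F x \<partial>M) p < top \<or> (\<integral>\<^sup>+x. epow (F x) p \<partial>M) < top \<Longrightarrow>
      epow (\<integral>\<^sup>+x. F x \<partial>M) p < (\<integral>\<^sup>+x. epow (F x) p \<partial>M)" by blast+
qed

lemma jensen_epow_neg:
  assumes emeasure_space_1: "emeasure M (space M) = 1"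
    and [measurable]: "F \<in> borel_measurable M" and p: "p < 0"
  shows "epow (\<integral>\<^sup>+x. F x \<partial>M) p \<le> (\<integral>\<^sup>+x. epow (F x) p \<partial>M)"
    and "\<not> (\<exists>c. AE x in M. F x = c) \<Longrightarrow>
      epow (\<integral>\<^sup>+x. F x \<partial>M) p < top \<or> (\<integral>\<^sup>+x. epow (F x) p \<partial>M) < top \<Longrightarrow>
      epow (\<integral>\<^sup>+x. F x \<partial>M) p < (\<integral>\<^sup>+x. epow (F x) p \<partial>M)"
proof -
  let ?A = "\<integral>\<^sup>+x. epow (F x) p \<partial>M"
  have "epow (\<integral>\<^sup>+x. F x \<partial>M) p \<le> ?A \<and> (\<not> (\<exists>c. AE x in M. F x = c) \<longrightarrow>
      epow (\<integral>\<^sup>+x. F x \<partial>M) p < top \<or> ?A < top \<longrightarrow> epow (\<integral>\<^sup>+x. F x \<partial>M) p < ?A)"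
  proof (cases "\<integral>\<^sup>+x. F x \<partial>M" rule: ennreal_zero_pos_top_cases)
    case 1
    then have ae: "AE x in M. F x = 0" by (simp add: nn_integral_0_iff_AE)
    then have "?A = (\<integral>\<^sup>+x. top \<partial>M)"
      using p by (intro nn_integral_cong_AE) (auto elim!: eventually_mono)
    then have "?A = top" by (simp add: emeasure_space_1)
    moreover have "\<exists>c. AE x in M. F x = c" using ae by (rule exI[of _ 0])
    ultimately show ?thesis by (simp only: top_greatest simp_thms)
  next
    case 2
    have "?A \<noteq> 0" if "\<not> (\<exists>c. AE x in M. F x = c)"
      using that p by (auto simp: nn_integral_0_iff_AE epow_eq_0_iff)
    with 2 p show ?thesis by (auto simp: zero_less_iff_neq_zero)
  next
    case (3 s)
    let ?c = "- p * s powr (p - 1)" and ?d = "(1 - p) * s powr p"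
    have c: "0 \<le> ?c" and d: "0 \<le> ?d" using p 3 by (auto simp: mult_nonpos_nonneg)
    have S: "epow (\<integral>\<^sup>+x. F x \<partial>M) p = ennreal (s powr p)" using 3 by (simp add: epow_ennreal)
    have "(\<integral>\<^sup>+x. ennreal ?c * F x \<partial>M) = ennreal ?c * ennreal s"
      using 3 by (simp add: nn_integral_cmult)
    also have "\<dots> = ennreal (?c * s)" using 3 c by (intro ennreal_mult[symmetric]) auto
    also have "?c * s = - p * s powr p" using 3 by (simp add: powr_diff)
    finally have R: "(\<integral>\<^sup>+x. epow (F x) p + ennreal ?c * F x \<partial>M) = ?A + ennreal (- p * s powr p)"
      by (simp add: nn_integral_add)
    have L: "(\<integral>\<^sup>+x. ennreal ?d \<partial>M) = ennreal ?d" by (simp add: emeasure_space_1)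
    have e: "0 \<le> - p * s powr p" using p by (auto simp: mult_nonpos_nonneg)
    show ?thesis
    proof (cases ?A)
      case top
      with S show ?thesis by simp
    next
      case (real a)
      have R': "?A + ennreal (- p * s powr p) = ennreal (a + - p * s powr p)"
        unfolding real(2) using real e by (intro ennreal_plus[symmetric]) auto
      have "(\<integral>\<^sup>+x. ennreal ?d \<partial>M) \<le> (\<integral>\<^sup>+x. epow (F x) p + ennreal ?c * F x \<partial>M)"
        by (intro nn_integral_mono epow_tangent_neg(1)[OF p \<open>0 < s\<close>])
      then have "ennreal ?d \<le> ennreal (a + - p * s powr p)" unfolding L R R' .
      then have "?d \<le> a + - p * s powr p"
        using real e by (subst (asm) ennreal_le_iff) (auto intro!: add_nonneg_nonneg)
      then have le: "s powr p \<le> a" by (simp add: algebra_simps)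
      have "s powr p < a" if nc: "\<not> (\<exists>c. AE x in M. F x = c)"
      proof -
        have "(\<integral>\<^sup>+x. ennreal ?d \<partial>M) < (\<integral>\<^sup>+x. epow (F x) p + ennreal ?c * F x \<partial>M)"
        proof (rule nn_integral_less)
          show "\<not> (AE x in M. epow (F x) p + ennreal ?c * F x \<le> ennreal ?d)"
          proof
            assume "AE x in M. epow (F x) p + ennreal ?c * F x \<le> ennreal ?d"
            then have "AE x in M. F x = ennreal s"
              by eventually_elim (metis epow_tangent_neg(2)[OF p \<open>0 < s\<close>] not_le)
            with nc show False by blast
          qed
          show "AE x in M. ennreal ?d \<le> epow (F x) p + ennreal ?c * F x"
            by (intro AE_I2 epow_tangent_neg(1)[OF p \<open>0 < s\<close>])
          show "(\<integral>\<^sup>+x. ennreal ?d \<partial>M) \<noteq> \<infinity>" unfolding L by simp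
        qed auto
        then have "ennreal ?d < ennreal (a + - p * s powr p)" unfolding L R R' .
        then have "?d < a + - p * s powr p" using d by (subst (asm) ennreal_less_iff) auto
        then show ?thesis by (simp add: algebra_simps)
      qed
      with le show ?thesis unfolding S real(2) by (auto simp: ennreal_less_iff ennreal_leI)
    qed
  qed
  then show "epow (\<integral>\<^sup>+x. F x \<partial>M) p \<le> (\<integral>\<^sup>+x. epow (F x) p \<partial>M)"
    and "\<not> (\<exists>c. AE x in M. F x = c) \<Longrightarrow>
      epow (\<integral>\<^sup>+x. F x \<partial>M) p < top \<or> (\<integral>\<^sup>+x. epow (F x) p \<partial>M) < top \<Longrightarrow>
      epow (\<integral>\<^sup>+x. F x \<partial>M) p < (\<integral>\<^sup>+x. epow (F x) p \<partial>M)" by blast+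
qed

section \<open>Averaging operators on a space of infinite measure\<close>

text \<open>\<open>H\<close> is a positive kernel both of whose marginals are \<open>1\<close>, on a \<open>\<sigma>\<close>-finite space of infinite
  measure. The operator is \<open>S F y = \<integral> H x y F x dx\<close>.\<close>

context
  fixes M :: "'a measure" and H :: "'a \<Rightarrow> 'a \<Rightarrow> ennreal"
  assumes sigma_finite: "sigma_finite_measure M"
    and infinite: "emeasure M (space M) = top"
    and H_measurable [measurable]: "(\<lambda>(x, y). H x y) \<in> borel_measurable (M \<Otimes>\<^sub>M M)"
    and H_pos: "\<And>x y. x \<in> space M \<Longrightarrow> y \<in> space M \<Longrightarrow> 0 < H x y"
    and H_first: "\<And>y. y \<in> space M \<Longrightarrow> (\<integral>\<^sup>+x. H x y \<partial>M) = 1"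
    and H_second: "\<And>x. x \<in> space M \<Longrightarrow> (\<integral>\<^sup>+y. H x y \<partial>M) = 1"
begin

lemma markov_nn_integral:
  assumes [measurable]: "F \<in> borel_measurable M"
  shows "(\<integral>\<^sup>+y. (\<integral>\<^sup>+x. H x y * F x \<partial>M) \<partial>M) = (\<integral>\<^sup>+x. F x \<partial>M)"
proof -
  interpret sigma_finite_measure M by (rule sigma_finite)
  interpret pair_sigma_finite M M ..
  have "(\<integral>\<^sup>+y. (\<integral>\<^sup>+x. H x y * F x \<partial>M) \<partial>M) = (\<integral>\<^sup>+x. (\<integral>\<^sup>+y. H x y * F x \<partial>M) \<partial>M)"
    by (rule Fubini') measurable
  also have "\<dots> = (\<integral>\<^sup>+x. (\<integral>\<^sup>+y. H x y \<partial>M) * F x \<partial>M)"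
    by (intro nn_integral_cong nn_integral_multc) measurable
  also have "\<dots> = (\<integral>\<^sup>+x. F x \<partial>M)"
    by (intro nn_integral_cong) (simp add: H_second)
  finally show ?thesis .
qed

lemma markov_measurable [measurable]:
  assumes [measurable]: "F \<in> borel_measurable M"
  shows "(\<lambda>y. \<integral>\<^sup>+x. H x y * F x \<partial>M) \<in> borel_measurable M"
proof -
  interpret sigma_finite_measure M by (rule sigma_finite)
  show ?thesis by measurable
qed

text \<open>Jensen's inequality for the probability measure \<open>H x y dx\<close>, which has the same null sets as
  \<open>M\<close> because \<open>H\<close> is positive.\<close>

lemma markov_jensen:
  assumes [measurable]: "F \<in> borel_measurable M" and y: "y \<in> space M" and r: "r > 1 \<or> r < 0"
    and nc: "\<not> (\<exists>c. AE x in M. F x = c)"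
  shows "epow (\<integral>\<^sup>+x. H x y * F x \<partial>M) r \<le> (\<integral>\<^sup>+x. H x y * epow (F x) r \<partial>M)"
    and "epow (\<integral>\<^sup>+x. H x y * F x \<partial>M) r < top \<or> (\<integral>\<^sup>+x. H x y * epow (F x) r \<partial>M) < top \<Longrightarrow>
      epow (\<integral>\<^sup>+x. H x y * F x \<partial>M) r < (\<integral>\<^sup>+x. H x y * epow (F x) r \<partial>M)"
proof -
  have Hy [measurable]: "(\<lambda>x. H x y) \<in> borel_measurable M" using y by measurable
  let ?N = "density M (\<lambda>x. H x y)"
  have one: "emeasure ?N (space ?N) = 1"
    using H_first[OF y] by (simp add: emeasure_density cong: nn_integral_cong)
  have F: "F \<in> borel_measurable ?N" by simp
  have dens: "(\<integral>\<^sup>+x. u x \<partial>?N) = (\<integral>\<^sup>+x. H x y * u x \<partial>M)" if "u \<in> borel_measurable M" for u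
    using that by (simp add: nn_integral_density)
  have nc': "\<not> (\<exists>c. AE x in ?N. F x = c)"
  proof
    assume "\<exists>c. AE x in ?N. F x = c"
    then obtain c where "AE x in M. 0 < H x y \<longrightarrow> F x = c" by (auto simp: AE_density)
    then have "AE x in M. F x = c" using H_pos y by (auto elim!: AE_mp)
    with nc show False by blast
  qed
  show "epow (\<integral>\<^sup>+x. H x y * F x \<partial>M) r \<le> (\<integral>\<^sup>+x. H x y * epow (F x) r \<partial>M)"
    using r jensen_epow_gt_1(1)[OF one F] jensen_epow_neg(1)[OF one F] by (auto simp: dens)
  show "epow (\<integral>\<^sup>+x. H x y * F x \<partial>M) r < (\<integral>\<^sup>+x. H x y * epow (F x) r \<partial>M)"
    if "epow (\<integral>\<^sup>+x. H x y * F x \<partial>M) r < top \<or> (\<integral>\<^sup>+x. H x y * epow (F x) r \<partial>M) < top"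
    using r jensen_epow_gt_1(2)[OF one F _ nc'] jensen_epow_neg(2)[OF one F _ nc'] that by (auto simp: dens)
qed

text \<open>On a space of infinite measure the integral of a constant is \<open>0\<close> or \<open>\<infinity>\<close>.\<close>

lemma not_AE_const:
  assumes "0 < (\<integral>\<^sup>+x. epow (F x) p \<partial>M)" "(\<integral>\<^sup>+x. epow (F x) p \<partial>M) < top"
  shows "\<not> (\<exists>c. AE x in M. F x = c)"
proof
  assume "\<exists>c. AE x in M. F x = c"
  then obtain c where "AE x in M. F x = c" by blast
  then have "(\<integral>\<^sup>+x. epow (F x) p \<partial>M) = (\<integral>\<^sup>+x. epow c p \<partial>M)"
    by (intro nn_integral_cong_AE) auto
  then have "(\<integral>\<^sup>+x. epow (F x) p \<partial>M) = epow c p * top" by (simp add: infinite)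
  with assms show False by (cases "epow c p = 0") (auto simp: ennreal_mult_top)
qed

lemma not_AE_le_if_AE_less:
  fixes f g :: "'a \<Rightarrow> ennreal"
  assumes "AE x in M. f x < g x" shows "\<not> (AE x in M. g x \<le> f x)"
proof
  assume "AE x in M. g x \<le> f x"
  with assms have "AE x in M. False" by eventually_elim simp
  then show False using infinite by (auto simp: AE_iff_null)
qed

theorem markov_norm_less:
  assumes F [measurable]: "F \<in> borel_measurable M" and p: "p > 1 \<or> p < 0"
    and "0 < (\<integral>\<^sup>+x. epow (F x) p \<partial>M)" "(\<integral>\<^sup>+x. epow (F x) p \<partial>M) < top"
  shows "(\<integral>\<^sup>+y. epow (\<integral>\<^sup>+x. H x y * F x \<partial>M) p \<partial>M) < (\<integral>\<^sup>+x. epow (F x) p \<partial>M)"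
proof -
  let ?S = "\<lambda>y. epow (\<integral>\<^sup>+x. H x y * F x \<partial>M) p" and ?T = "\<lambda>y. \<integral>\<^sup>+x. H x y * epow (F x) p \<partial>M"
  have T: "(\<integral>\<^sup>+y. ?T y \<partial>M) = (\<integral>\<^sup>+x. epow (F x) p \<partial>M)" by (intro markov_nn_integral) simp
  have [measurable]: "?T \<in> borel_measurable M" by (intro markov_measurable) simp
  note jensen = markov_jensen[OF F _ p not_AE_const[OF assms(3,4)]]
  have le: "AE y in M. ?S y \<le> ?T y" using jensen(1) by (intro AE_I2)
  have "(\<integral>\<^sup>+y. ?S y \<partial>M) < (\<integral>\<^sup>+y. ?T y \<partial>M)"
  proof (rule nn_integral_less)
    show "(\<integral>\<^sup>+y. ?S y \<partial>M) \<noteq> \<infinity>"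
      using nn_integral_mono_AE[OF le] assms(4) unfolding T by (auto simp: top_unique)
    have "AE y in M. ?T y \<noteq> \<infinity>"
      using assms(4) T by (intro nn_integral_PInf_AE) auto
    then have "AE y in M. ?S y < ?T y"
      using AE_space by eventually_elim (intro jensen(2), auto simp: less_top)
    then show "\<not> (AE y in M. ?T y \<le> ?S y)"
      by (rule not_AE_le_if_AE_less)
  qed (use le in auto)
  then show ?thesis unfolding T .
qed

text \<open>For \<open>0 < p < 1\<close> the convex case applies to \<open>F powr p\<close> with the exponent \<open>1 / p > 1\<close>.\<close>

theorem markov_norm_greater:
  assumes F [measurable]: "F \<in> borel_measurable M" and p: "0 < p" "p < 1"
    and "0 < (\<integral>\<^sup>+x. epow (F x) p \<partial>M)" "(\<integral>\<^sup>+x. epow (F x) p \<partial>M) < top"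
  shows "(\<integral>\<^sup>+x. epow (F x) p \<partial>M) < (\<integral>\<^sup>+y. epow (\<integral>\<^sup>+x. H x y * F x \<partial>M) p \<partial>M)"
proof -
  let ?S = "\<lambda>y. epow (\<integral>\<^sup>+x. H x y * F x \<partial>M) p" and ?T = "\<lambda>y. \<integral>\<^sup>+x. H x y * epow (F x) p \<partial>M"
  have T: "(\<integral>\<^sup>+y. ?T y \<partial>M) = (\<integral>\<^sup>+x. epow (F x) p \<partial>M)" by (intro markov_nn_integral) simp
  have [measurable]: "?T \<in> borel_measurable M" by (intro markov_measurable) simp
  have r: "1 / p > 1 \<or> 1 / p < 0" using p by simp
  have nc: "\<not> (\<exists>c. AE x in M. epow (F x) p = c)"
    using assms(4,5) by (intro not_AE_const[of _ 1]) (simp_all add: epow_one)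
  have Fp: "(\<lambda>x. epow (F x) p) \<in> borel_measurable M" by simp
  have inv: "epow (epow a p) (1 / p) = a" "epow (epow a (1 / p)) p = a" for a
    using p by (simp_all add: epow_epow epow_one)
  have less: "?T y < ?S y" if "y \<in> space M" "?T y \<noteq> \<infinity>" for y
  proof -
    have "epow (?T y) (1 / p) < (\<integral>\<^sup>+x. H x y * epow (epow (F x) p) (1 / p) \<partial>M)"
      using that p epow_eq_top_iff[of "1 / p" "?T y"]
      by (intro markov_jensen(2)[OF Fp _ r nc]) (auto simp: less_top)
    then have "epow (epow (?T y) (1 / p)) p < ?S y"
      using p by (intro epow_strict_mono) (auto simp: inv)
    then show ?thesis by (simp add: inv)
  qed
  have "(\<integral>\<^sup>+y. ?T y \<partial>M) < (\<integral>\<^sup>+y. ?S y \<partial>M)"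
  proof (rule nn_integral_less)
    have "AE y in M. ?T y \<noteq> \<infinity>"
      using assms(5) T by (intro nn_integral_PInf_AE) auto
    then have lt: "AE y in M. ?T y < ?S y"
      using AE_space by eventually_elim (intro less)
    then show "AE y in M. ?T y \<le> ?S y" by eventually_elim simp
    show "\<not> (AE y in M. ?S y \<le> ?T y)"
      using lt by (rule not_AE_le_if_AE_less)
    show "(\<integral>\<^sup>+y. ?T y \<partial>M) \<noteq> \<infinity>" using T assms(5) by simp
  qed auto
  then show ?thesis unfolding T .
qed

end

text \<open>Dividing by the norm \<open>A powr (1 / r)\<close> divides the integral of the \<open>r\<close>-th powers by \<open>A\<close>.\<close>

lemma nn_integral_epow_scaled:
  assumes [measurable]: "S \<in> borel_measurable M" and "0 < A" "r \<noteq> 0"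
  shows "(\<integral>\<^sup>+x. epow (ennreal (A powr (- 1 / r)) * S x) r \<partial>M)
    = ennreal (1 / A) * (\<integral>\<^sup>+x. epow (S x) r \<partial>M)"
proof -
  have "(A powr (- 1 / r)) powr r = 1 / A"
    using assms by (simp only: powr_powr) (simp add: powr_minus_divide)
  then show ?thesis
    using assms by (simp add: epow_cmult nn_integral_cmult)
qed

lemma ennreal_inverse_mult_less_1:
  assumes "0 < A" "x < ennreal A" shows "ennreal (1 / A) * x < 1"
proof (cases x)
  case (real r)
  with assms show ?thesis by (simp add: ennreal_less_iff flip: ennreal_mult)
qed (use assms in auto)

lemma ennreal_inverse_mult_gt_1:
  assumes "0 < A" "ennreal A < x" shows "1 < ennreal (1 / A) * x"
proof (cases x)
  case (real r)
  with assms show ?thesis by (simp add: ennreal_less_iff flip: ennreal_mult ennreal_1)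
qed (use assms in \<open>auto simp: ennreal_mult_top\<close>)

text \<open>Hoelder's inequality and its reverses, with the strictness inherited from the norm of \<open>S\<close>. For
  \<open>p < 0\<close> it is \<open>q\<close> that lies in \<open>(0,1)\<close>, so the reversed Young inequality is used with the roles of
  \<open>S\<close> and \<open>G\<close> exchanged.\<close>

lemma holder_normalised:
  assumes S [measurable]: "S \<in> borel_measurable M" and G [measurable]: "G \<in> borel_measurable M"
    and pq: "1 / p + 1 / q = 1" and p: "p \<noteq> 0" "p \<noteq> 1"
    and B: "(\<integral>\<^sup>+x. epow (G x) q \<partial>M) = 1"
  shows "p > 1 \<Longrightarrow> (\<integral>\<^sup>+x. epow (S x) p \<partial>M) < 1 \<Longrightarrow> (\<integral>\<^sup>+x. S x * G x \<partial>M) < 1"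
    and "0 < p \<Longrightarrow> p < 1 \<Longrightarrow> 1 < (\<integral>\<^sup>+x. epow (S x) p \<partial>M) \<Longrightarrow> 1 < (\<integral>\<^sup>+x. S x * G x \<partial>M)"
    and "p < 0 \<Longrightarrow> (\<integral>\<^sup>+x. epow (S x) p \<partial>M) < 1 \<Longrightarrow> 1 < (\<integral>\<^sup>+x. S x * G x \<partial>M)"
proof -
  let ?J = "\<integral>\<^sup>+x. epow (S x) p \<partial>M" and ?I = "\<integral>\<^sup>+x. S x * G x \<partial>M"
  show "?I < 1" if "p > 1" "?J < 1"
  proof -
    obtain j where j: "?J = ennreal j" "0 \<le> j" "j < 1"
      using \<open>?J < 1\<close> by (cases ?J) (auto simp: ennreal_less_one_iff)
    have q: "0 < 1 / q" using pq that(1) by (smt (verit) divide_less_eq_1_pos)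
    have "?I \<le> (\<integral>\<^sup>+x. ennreal (1 / p) * epow (S x) p + ennreal (1 / q) * epow (G x) q \<partial>M)"
      by (intro nn_integral_mono epow_young[OF that(1) pq])
    also have "\<dots> = ennreal (1 / p) * ?J + ennreal (1 / q)"
      by (simp add: nn_integral_add nn_integral_cmult B)
    also have "\<dots> = ennreal (1 / p * j + 1 / q)"
      using j q that by (simp add: ennreal_mult ennreal_plus del: ennreal_plus add: ennreal_plus flip: ennreal_mult)
    also have "\<dots> < ennreal 1"
    proof (rule ennreal_lessI)
      have "1 / p * j < 1 / p * 1" using that j by (intro mult_strict_left_mono) auto
      with pq show "1 / p * j + 1 / q < 1" by linarith
    qed simp
    finally show ?thesis by simp
  qed
  show "1 < ?I" if "0 < p" "p < 1" "1 < ?J"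
  proof -
    have p1: "1 < 1 / p" using that by simp
    then have q: "1 / q < 0" using pq by linarith
    have "(\<integral>\<^sup>+x. ennreal (1 / p) * epow (S x) p \<partial>M)
        \<le> (\<integral>\<^sup>+x. S x * G x + ennreal (- 1 / q) * epow (G x) q \<partial>M)"
      by (intro nn_integral_mono epow_young_reverse[OF that(1,2) pq])
    then have le: "ennreal (1 / p) * ?J \<le> ?I + ennreal (- 1 / q)"
      by (simp add: nn_integral_add nn_integral_cmult B)
    have "ennreal (1 / p) * 1 < ennreal (1 / p) * ?J"
      using that by (intro ennreal_mult_strict_left_mono) auto
    with le have less: "ennreal (1 / p) < ?I + ennreal (- 1 / q)" by simp
    show ?thesis
    proof (cases ?I)
      case (real i)
      have "ennreal (1 / p) < ennreal (i + - 1 / q)"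
        using less real q by (simp add: ennreal_plus[symmetric] del: ennreal_plus)
      then have "1 / p < i + - 1 / q" using that by (subst (asm) ennreal_less_iff) auto
      with pq have "1 < i" by simp
      with real show ?thesis by (simp flip: ennreal_1 add: ennreal_less_iff)
    qed simp
  qed
  show "1 < ?I" if "p < 0" "?J < 1"
  proof -
    obtain j where j: "?J = ennreal j" "0 \<le> j" "j < 1"
      using \<open>?J < 1\<close> by (cases ?J) (auto simp: ennreal_less_one_iff)
    have "1 / p < 0" using that by simp
    then have q1: "1 / q > 1" using pq by linarith
    then have "0 < 1 / q" by linarith
    then have q0: "0 < q" by simp
    with q1 have q: "0 < q" "q < 1" by (simp_all add: field_simps)
    have qp: "1 / q + 1 / p = 1" using pq by simp
    have "(\<integral>\<^sup>+x. ennreal (1 / q) * epow (G x) q \<partial>M)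
        \<le> (\<integral>\<^sup>+x. G x * S x + ennreal (- 1 / p) * epow (S x) p \<partial>M)"
      by (intro nn_integral_mono epow_young_reverse[OF q qp])
    moreover have "(\<integral>\<^sup>+x. G x * S x \<partial>M) = ?I" by (simp only: mult.commute)
    ultimately have le: "ennreal (1 / q) \<le> ?I + ennreal (- 1 / p) * ?J"
      by (simp add: nn_integral_add nn_integral_cmult B)
    show ?thesis
    proof (cases ?I)
      case (real i)
      have "ennreal (- 1 / p) * ?J = ennreal (- 1 / p * j)"
        unfolding j(1) using that j by (intro ennreal_mult[symmetric]) auto
      then have "?I + ennreal (- 1 / p) * ?J = ennreal (i + - 1 / p * j)"
        using real j that ennreal_plus[of i "- 1 / p * j"]
        by (simp add: divide_nonneg_neg divide_nonneg_nonpos)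
      with le have "ennreal (1 / q) \<le> ennreal (i + - 1 / p * j)" by simp
      then have "1 / q \<le> i + - 1 / p * j"
        using real(1) divide_nonneg_neg[OF j(2) that(1)] by (subst (asm) ennreal_le_iff) auto
      moreover have "- 1 / p * j < - 1 / p * 1" using that j by (intro mult_strict_left_mono) auto
      ultimately have "1 < i" using pq by simp
      with real show ?thesis by (simp flip: ennreal_1 add: ennreal_less_iff)
    qed simp
  qed
qed

section \<open>Haar measure on the multiplicative half-line\<close>

text \<open>The measure \<open>dx/x\<close> on the Lebesgue sets of \<open>(0,\<infinity>)\<close>, so that functions that are merely Lebesgue
  measurable stay measurable.\<close>

definition haar :: "real measure" where
  "haar = density Rpos (\<lambda>x. ennreal (1 / x))"

lemma space_haar [simp]: "space haar = {0<..}"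
  by (simp add: haar_def)

lemma sets_haar: "sets haar = sets Rpos"
  by (simp add: haar_def)

lemma measurable_haar_iff: "f \<in> borel_measurable haar \<longleftrightarrow> f \<in> borel_measurable Rpos"
  by (simp add: haar_def)

lemma borel_measurable_Rpos:
  "f \<in> borel_measurable borel \<Longrightarrow> f \<in> borel_measurable Rpos"
  by (intro measurable_restrict_space1 measurable_completion) simp

lemma borel_measurable_haar:
  "f \<in> borel_measurable borel \<Longrightarrow> f \<in> borel_measurable haar"
  by (simp add: measurable_haar_iff borel_measurable_Rpos)

lemma ident_measurable_haar [measurable]: "(\<lambda>x. x) \<in> haar \<rightarrow>\<^sub>M borel"
  by (intro borel_measurable_haar) simp

lemma nn_integral_haar:
  assumes "u \<in> borel_measurable Rpos"
  shows "(\<integral>\<^sup>+x. u x \<partial>haar) = (\<integral>\<^sup>+x. ennreal (1 / x) * u x \<partial>Rpos)"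
  unfolding haar_def
  by (rule nn_integral_density[OF borel_measurable_Rpos assms]) simp

lemma nn_integral_Rpos_eq_haar:
  assumes "u \<in> borel_measurable Rpos"
  shows "(\<integral>\<^sup>+x. u x \<partial>Rpos) = (\<integral>\<^sup>+x. ennreal x * u x \<partial>haar)"
proof -
  have [measurable]: "(\<lambda>x. ennreal x) \<in> borel_measurable Rpos"
    by (intro borel_measurable_Rpos) simp
  have "(\<integral>\<^sup>+x. ennreal x * u x \<partial>haar) = (\<integral>\<^sup>+x. ennreal (1 / x) * (ennreal x * u x) \<partial>Rpos)"
    using assms by (intro nn_integral_haar) simp
  also have "\<dots> = (\<integral>\<^sup>+x. u x \<partial>Rpos)"
    by (intro nn_integral_cong) (auto simp flip: mult.assoc ennreal_mult)
  finally show ?thesis by simp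
qed

lemma nn_integral_Rpos_borel:
  assumes "u \<in> borel_measurable borel"
  shows "(\<integral>\<^sup>+x. u x \<partial>Rpos) = (\<integral>\<^sup>+x. u x * indicator {0<..} x \<partial>lborel)"
  by (subst nn_integral_restrict_space) (auto simp: nn_integral_completion)

text \<open>The exponential function transports Lebesgue measure on the line to \<^const>\<open>haar\<close>; the
  substitution is made on \<open>[-n, n]\<close> and \<open>n\<close> tends to infinity.\<close>

lemma nn_integral_haar_exp:
  fixes u :: "real \<Rightarrow> ennreal"
  assumes [measurable]: "u \<in> borel_measurable borel"
  shows "(\<integral>\<^sup>+x. u x \<partial>haar) = (\<integral>\<^sup>+s. u (exp s) \<partial>lborel)"
proof -
  define f where "f = (\<lambda>x. ennreal (1 / x) * u x)"
  have [measurable]: "f \<in> borel_measurable borel" by (simp add: f_def)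
  have inc: "incseq (\<lambda>n x. g x * indicator {exp (- real n)..exp (real n)} x)"
    "incseq (\<lambda>n x. g x * indicator {- real n..real n} x)" for g :: "real \<Rightarrow> ennreal"
  proof -
    have *: "incseq (\<lambda>n x. g x * indicator (A n) x)" if "incseq A" for A :: "nat \<Rightarrow> real set"
      using that by (auto simp: incseq_def le_fun_def intro!: mult_left_mono indicator_leI)
    show "incseq (\<lambda>n x. g x * indicator {exp (- real n)..exp (real n)} x)"
      "incseq (\<lambda>n x. g x * indicator {- real n..real n} x)"
      by (intro *; simp add: incseq_def)+
  qed
  have S1: "(SUP n. g x * indicator {- real n..real n} x) = g x" for g :: "real \<Rightarrow> ennreal" and x
  proof -
    obtain n :: nat where n: "\<bar>x\<bar> \<le> real n" using real_arch_simple by blast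
    show ?thesis
      by (intro antisym SUP_least SUP_upper2[of n])
        (use n in \<open>auto split: split_indicator\<close>)
  qed
  have S2: "(SUP n. g x * indicator {exp (- real n)..exp (real n)} x) = g x * indicator {0<..} x"
    for g :: "real \<Rightarrow> ennreal" and x
  proof (cases "x > 0")
    case True
    then have "indicator {exp (- real n)..exp (real n)} x = (indicator {- real n..real n} (ln x) :: ennreal)" for n
      using exp_le_cancel_iff[of "- real n" "ln x"] exp_le_cancel_iff[of "ln x" "real n"]
      by (simp add: indicator_def)
    with S1[of "\<lambda>_. g x" "ln x"] True show ?thesis by simp
  next
    case False
    then have "x < exp y" for y :: real by (smt (verit) exp_gt_zero)
    with False show ?thesis by (auto split: split_indicator simp: not_le[symmetric])
  qed
  have "(\<integral>\<^sup>+x. u x \<partial>haar) = (\<integral>\<^sup>+x. f x * indicator {0<..} x \<partial>lborel)"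
    unfolding f_def by (simp add: nn_integral_haar borel_measurable_Rpos nn_integral_Rpos_borel)
  also have "\<dots> = (\<integral>\<^sup>+x. (SUP n. f x * indicator {exp (- real n)..exp (real n)} x) \<partial>lborel)"
    by (simp only: S2)
  also have "\<dots> = (SUP n. \<integral>\<^sup>+x. f x * indicator {exp (- real n)..exp (real n)} x \<partial>lborel)"
    by (intro nn_integral_monotone_convergence_SUP inc) auto
  also have "\<dots> = (SUP n. \<integral>\<^sup>+s. u (exp s) * indicator {- real n..real n} s \<partial>lborel)"
  proof (intro SUP_cong refl)
    fix n :: nat
    show "(\<integral>\<^sup>+x. f x * indicator {exp (- real n)..exp (real n)} x \<partial>lborel)
        = (\<integral>\<^sup>+s. u (exp s) * indicator {- real n..real n} s \<partial>lborel)"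
    \<comment> \<open>the substitution rule needs a nondegenerate interval\<close>
    proof (cases "n = 0")
      case True
      have "(\<integral>\<^sup>+x. g x * indicator {c..c} x \<partial>lborel) = 0" for g :: "real \<Rightarrow> ennreal" and c
        by simp
      from this[of f 1] this[of "\<lambda>s. u (exp s)" 0] True show ?thesis by simp
    next
      case False
      have "(\<integral>\<^sup>+x. f x * indicator {exp (- real n)..exp (real n)} x \<partial>lborel)
          = (\<integral>\<^sup>+s. f (exp s) * exp s * indicator {- real n..real n} s \<partial>lborel)"
        using False by (intro nn_integral_substitution_aux)
          (auto intro!: derivative_eq_intros continuous_intros)
      also have "\<dots> = (\<integral>\<^sup>+s. u (exp s) * indicator {- real n..real n} s \<partial>lborel)"
      proof (intro nn_integral_cong arg_cong2[where f = "(*)"] refl)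
        fix s :: real
        have "f (exp s) * ennreal (exp s) = (ennreal (1 / exp s) * ennreal (exp s)) * u (exp s)"
          by (simp only: f_def mult_ac)
        also have "ennreal (1 / exp s) * ennreal (exp s) = 1"
          by (simp flip: ennreal_mult)
        finally show "f (exp s) * ennreal (exp s) = u (exp s)" by simp
      qed
      finally show ?thesis .
    qed
  qed
  also have "\<dots> = (\<integral>\<^sup>+s. (SUP n. u (exp s) * indicator {- real n..real n} s) \<partial>lborel)"
    by (intro nn_integral_monotone_convergence_SUP[symmetric] inc) auto
  also have "\<dots> = (\<integral>\<^sup>+s. u (exp s) \<partial>lborel)"
    by (simp only: S1[of "\<lambda>s. u (exp s)"])
  finally show ?thesis .
qed

lemma nn_integral_haar_scale:
  fixes u :: "real \<Rightarrow> ennreal"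
  assumes [measurable]: "u \<in> borel_measurable borel" and "0 < y"
  shows "(\<integral>\<^sup>+x. u (x / y) \<partial>haar) = (\<integral>\<^sup>+x. u x \<partial>haar)"
proof -
  have "(\<integral>\<^sup>+x. u (x / y) \<partial>haar) = (\<integral>\<^sup>+s. u (exp s / y) \<partial>lborel)"
    by (intro nn_integral_haar_exp) simp
  also have "\<dots> = (\<integral>\<^sup>+s. u (exp (ln y + 1 * s) / y) \<partial>lborel)"
    by (subst nn_integral_real_affine[where c = 1 and t = "ln y"]) simp_all
  also have "\<dots> = (\<integral>\<^sup>+x. u x \<partial>haar)"
    using assms(2) by (simp add: nn_integral_haar_exp exp_add)
  finally show ?thesis .
qed

lemma nn_integral_haar_invert:
  fixes u :: "real \<Rightarrow> ennreal"
  assumes [measurable]: "u \<in> borel_measurable borel" and "0 < x"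
  shows "(\<integral>\<^sup>+y. u (x / y) \<partial>haar) = (\<integral>\<^sup>+x. u x \<partial>haar)"
proof -
  have "(\<integral>\<^sup>+y. u (x / y) \<partial>haar) = (\<integral>\<^sup>+s. u (x / exp s) \<partial>lborel)"
    by (intro nn_integral_haar_exp) simp
  also have "\<dots> = (\<integral>\<^sup>+s. u (x / exp (ln x + - 1 * s)) \<partial>lborel)"
    by (subst nn_integral_real_affine[where c = "- 1" and t = "ln x"]) simp_all
  also have "\<dots> = (\<integral>\<^sup>+x. u x \<partial>haar)"
    using assms(2) by (simp add: nn_integral_haar_exp exp_diff)
  finally show ?thesis .
qed

lemma nn_integral_haar_Icc:
  assumes "0 < a" "a \<le> b"
  shows "(\<integral>\<^sup>+x. indicator {a..b} x \<partial>haar) = ennreal (ln b - ln a)"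
  using nn_integral_inverse_Icc[OF assms]
  by (simp add: nn_integral_haar borel_measurable_Rpos)

lemma emeasure_haar_Icc:
  assumes "0 < a" "a \<le> b"
  shows "{a..b} \<in> sets haar" "emeasure haar {a..b} = ennreal (ln b - ln a)"
proof -
  have "{a..b} \<in> sets (restrict_space lebesgue {0<..})"
    using assms by (subst sets_restrict_space_iff) auto
  then show *: "{a..b} \<in> sets haar" by (simp add: sets_haar)
  show "emeasure haar {a..b} = ennreal (ln b - ln a)"
    using nn_integral_haar_Icc[OF assms] by (simp add: nn_integral_indicator[OF *])
qed

lemma sigma_finite_haar: "sigma_finite_measure haar"
proof
  let ?A = "range (\<lambda>n::nat. {exp (- real n)..exp (real n)})"
  have "\<exists>n::nat. exp (- real n) \<le> x \<and> x \<le> exp (real n)" if "0 < x" for x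
  proof -
    obtain n :: nat where n: "\<bar>ln x\<bar> \<le> real n" using real_arch_simple by blast
    then have "exp (- real n) \<le> exp (ln x)" "exp (ln x) \<le> exp (real n)" by auto
    then show ?thesis using that by auto
  qed
  then have "\<Union>?A = space haar" by (auto intro: less_le_trans[OF exp_gt_zero])
  moreover have "?A \<subseteq> sets haar" using emeasure_haar_Icc(1) by auto
  moreover have "\<forall>a\<in>?A. emeasure haar a \<noteq> \<infinity>" by (auto simp: emeasure_haar_Icc(2))
  ultimately show "\<exists>A. countable A \<and> A \<subseteq> sets haar \<and> \<Union>A = space haar \<and> (\<forall>a\<in>A. emeasure haar a \<noteq> \<infinity>)"
    by (intro exI[of _ ?A]) auto
qed

lemma emeasure_haar_space: "emeasure haar (space haar) = top"
proof (rule ccontr)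
  assume "emeasure haar (space haar) \<noteq> top"
  then obtain n :: nat where n: "emeasure haar (space haar) < of_nat n"
    using ennreal_Ex_less_of_nat by (auto simp: less_top)
  have "of_nat n = emeasure haar {1..exp (real n)}"
    by (simp add: emeasure_haar_Icc ennreal_of_nat_eq_real_of_nat)
  also have "\<dots> \<le> emeasure haar (space haar)"
    by (rule emeasure_mono[OF _ sets.top]) auto
  finally show False using n by simp
qed

section \<open>The kernel and its integral\<close>

text \<open>The convolution kernel \<open>(coth u - 1) u powr \<sigma>\<close> on the multiplicative group.\<close>

definition kern :: "real \<Rightarrow> real \<Rightarrow> ennreal" where
  "kern \<sigma> u = ennreal ((coth u - 1) * u powr \<sigma>)"

lemma coth_measurable [measurable]: "coth \<in> borel_measurable borel"
  unfolding coth_def by measurable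

lemma kern_measurable [measurable]: "kern \<sigma> \<in> borel_measurable borel"
  unfolding kern_def by measurable

lemma coth_minus_1:
  assumes "0 < u" shows "coth u - 1 = 2 * exp (- 2 * u) / (1 - exp (- 2 * u))"
proof -
  have e: "exp (- u) * exp u = 1" by (simp flip: exp_add)
  have "exp u \<noteq> exp (- u)" using assms by simp
  moreover have "exp (- 2 * u) = exp (- u) * exp (- u)" by (simp flip: exp_add)
  moreover have "exp (- u) * exp (- u) \<noteq> 1" using assms by (simp flip: exp_add)
  ultimately show ?thesis
    unfolding coth_def using e
    by (simp add: divide_simps) (simp add: algebra_simps)
qed

lemma coth_gt_1: "0 < u \<Longrightarrow> 1 < coth u"
  using coth_minus_1[of u] by (smt (verit) divide_pos_pos exp_gt_zero exp_less_one_iff)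

lemma kern_pos: "0 < u \<Longrightarrow> 0 < kern \<sigma> u"
  using coth_gt_1[of u] by (simp add: kern_def)

lemma coth_minus_1_sums:
  assumes "0 < u"
  shows "(\<lambda>k. 2 * exp (- (2 * real (Suc k)) * u)) sums (coth u - 1)"
proof -
  have "(\<lambda>k. exp (- 2 * u) ^ k) sums (1 / (1 - exp (- 2 * u)))"
    using assms by (intro geometric_sums) simp
  then have "(\<lambda>k. 2 * exp (- 2 * u) * exp (- 2 * u) ^ k) sums (2 * exp (- 2 * u) * (1 / (1 - exp (- 2 * u))))"
    by (rule sums_mult)
  moreover have "(\<lambda>k. 2 * exp (- 2 * u) * exp (- 2 * u) ^ k) = (\<lambda>k. 2 * exp (- (2 * real (Suc k)) * u))"
    by (rule ext) (simp add: algebra_simps flip: exp_of_nat_mult exp_add)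
  moreover have "2 * exp (- 2 * u) * (1 / (1 - exp (- 2 * u))) = coth u - 1"
    unfolding coth_minus_1[OF assms] by simp
  ultimately show ?thesis by (simp only:)
qed

lemma nn_integral_haar_gamma:
  assumes "0 < \<sigma>" "0 < c"
  shows "(\<integral>\<^sup>+u. ennreal (exp (- c * u) * u powr \<sigma>) \<partial>haar) = ennreal (Gamma \<sigma> / c powr \<sigma>)"
proof -
  have [measurable]: "(\<lambda>u. ennreal (exp (- u) * u powr \<sigma>)) \<in> borel_measurable borel" by simp
  have "(\<integral>\<^sup>+u. ennreal (exp (- u) * u powr \<sigma>) \<partial>haar)
      = (\<integral>\<^sup>+u. ennreal (1 / u) * ennreal (exp (- u) * u powr \<sigma>) * indicator {0<..} u \<partial>lborel)"
    by (subst nn_integral_haar, simp add: borel_measurable_Rpos, subst nn_integral_Rpos_borel) simp_all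
  also have "\<dots> = (\<integral>\<^sup>+u. ennreal (indicator {0..} u * u powr (\<sigma> - 1) / exp u) \<partial>lborel)"
  proof (rule nn_integral_cong_AE, rule AE_mp[OF AE_lborel_singleton[of 0]], intro AE_I2 impI)
    fix u :: real assume "u \<noteq> 0"
    show "ennreal (1 / u) * ennreal (exp (- u) * u powr \<sigma>) * indicator {0<..} u
        = ennreal (indicator {0..} u * u powr (\<sigma> - 1) / exp u)"
    proof (cases "0 < u")
      case True
      then have "1 / u * (exp (- u) * u powr \<sigma>) = u powr (\<sigma> - 1) / exp u"
        by (simp add: powr_diff exp_minus divide_inverse)
      moreover have "ennreal (1 / u) * ennreal (exp (- u) * u powr \<sigma>)
          = ennreal (1 / u * (exp (- u) * u powr \<sigma>))"
        using True by (intro ennreal_mult[symmetric]) auto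
      ultimately show ?thesis using True by simp
    next
      case False
      with \<open>u \<noteq> 0\<close> show ?thesis by simp
    qed
  qed
  also have "\<dots> = ennreal (Gamma \<sigma>)" by (rule Gamma_conv_nn_integral_real[OF assms(1), symmetric])
  finally have G: "(\<integral>\<^sup>+u. ennreal (exp (- u) * u powr \<sigma>) \<partial>haar) = ennreal (Gamma \<sigma>)" .
  have "(\<integral>\<^sup>+u. ennreal (exp (- c * u) * u powr \<sigma>) \<partial>haar)
      = (\<integral>\<^sup>+u. ennreal (1 / c powr \<sigma>) * ennreal (exp (- (u / (1 / c))) * (u / (1 / c)) powr \<sigma>) \<partial>haar)"
  proof (rule nn_integral_cong)
    fix u assume "u \<in> space haar"
    then have "exp (- c * u) * u powr \<sigma> = 1 / c powr \<sigma> * (exp (- (u / (1 / c))) * (u / (1 / c)) powr \<sigma>)"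
      using assms by (simp add: powr_mult mult.commute)
    then show "ennreal (exp (- c * u) * u powr \<sigma>)
        = ennreal (1 / c powr \<sigma>) * ennreal (exp (- (u / (1 / c))) * (u / (1 / c)) powr \<sigma>)"
      by (subst ennreal_mult[symmetric]) auto
  qed
  also have "\<dots> = ennreal (1 / c powr \<sigma>) * (\<integral>\<^sup>+u. ennreal (exp (- (u / (1 / c))) * (u / (1 / c)) powr \<sigma>) \<partial>haar)"
    by (intro nn_integral_cmult borel_measurable_haar) simp
  also have "\<dots> = ennreal (1 / c powr \<sigma>) * ennreal (Gamma \<sigma>)"
    using assms G by (subst nn_integral_haar_scale[where u = "\<lambda>u. ennreal (exp (- u) * u powr \<sigma>)"]) simp_all
  finally show ?thesis using assms Gamma_real_pos[of \<sigma>] by (simp flip: ennreal_mult)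
qed

lemma zeta_summable: "\<sigma> > 1 \<Longrightarrow> summable (\<lambda>k. 1 / real (Suc k) powr \<sigma>)"
proof -
  assume "\<sigma> > 1"
  then have "summable (\<lambda>n. real n powr - \<sigma>)" by (simp add: summable_real_powr_iff)
  then have "summable (\<lambda>n. real (Suc n) powr - \<sigma>)" by (subst summable_Suc_iff)
  then show ?thesis by (simp add: powr_minus_divide)
qed

lemma K_const_pos: "\<sigma> > 1 \<Longrightarrow> 0 < K_const \<sigma>"
proof -
  assume s: "\<sigma> > 1"
  have "0 < zeta \<sigma>" unfolding zeta_def by (intro suminf_pos zeta_summable s) simp
  with s show ?thesis by (simp add: K_const_def Gamma_real_pos)
qed

lemma nn_integral_kern:
  assumes s: "\<sigma> > 1"
  shows "(\<integral>\<^sup>+u. kern \<sigma> u \<partial>haar) = ennreal (K_const \<sigma>)"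
proof -
  have "(\<integral>\<^sup>+u. kern \<sigma> u \<partial>haar)
      = (\<integral>\<^sup>+u. (\<Sum>k. 2 * ennreal (exp (- (2 * real (Suc k)) * u) * u powr \<sigma>)) \<partial>haar)"
  proof (rule nn_integral_cong)
    fix u assume "u \<in> space haar"
    then have "(\<lambda>k. 2 * exp (- (2 * real (Suc k)) * u) * u powr \<sigma>) sums ((coth u - 1) * u powr \<sigma>)"
      by (intro sums_mult2 coth_minus_1_sums) simp
    then have "(\<Sum>k. ennreal (2 * exp (- (2 * real (Suc k)) * u) * u powr \<sigma>)) = kern \<sigma> u"
      unfolding kern_def by (intro suminf_ennreal_eq) auto
    moreover have "ennreal (2 * exp (- (2 * real (Suc k)) * u) * u powr \<sigma>)
        = 2 * ennreal (exp (- (2 * real (Suc k)) * u) * u powr \<sigma>)" for k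
      by (simp add: mult.assoc ennreal_mult)
    ultimately show "kern \<sigma> u = (\<Sum>k. 2 * ennreal (exp (- (2 * real (Suc k)) * u) * u powr \<sigma>))" by simp
  qed
  also have "\<dots> = (\<Sum>k. \<integral>\<^sup>+u. 2 * ennreal (exp (- (2 * real (Suc k)) * u) * u powr \<sigma>) \<partial>haar)"
    by (intro nn_integral_suminf borel_measurable_haar) measurable
  also have "\<dots> = (\<Sum>k. ennreal (2 * (Gamma \<sigma> / (2 * real (Suc k)) powr \<sigma>)))"
  proof (intro suminf_cong)
    fix k
    have "(\<integral>\<^sup>+u. 2 * ennreal (exp (- (2 * real (Suc k)) * u) * u powr \<sigma>) \<partial>haar)
        = 2 * (\<integral>\<^sup>+u. ennreal (exp (- (2 * real (Suc k)) * u) * u powr \<sigma>) \<partial>haar)"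
      by (intro nn_integral_cmult borel_measurable_haar) measurable
    also have "\<dots> = 2 * ennreal (Gamma \<sigma> / (2 * real (Suc k)) powr \<sigma>)"
      using s by (subst nn_integral_haar_gamma) auto
    also have "\<dots> = ennreal (2 * (Gamma \<sigma> / (2 * real (Suc k)) powr \<sigma>))"
      using s Gamma_real_pos[of \<sigma>] by (subst ennreal_mult) auto
    finally show "(\<integral>\<^sup>+u. 2 * ennreal (exp (- (2 * real (Suc k)) * u) * u powr \<sigma>) \<partial>haar)
        = ennreal (2 * (Gamma \<sigma> / (2 * real (Suc k)) powr \<sigma>))" .
  qed
  also have "\<dots> = ennreal (K_const \<sigma>)"
  proof (rule suminf_ennreal_eq)
    show "0 \<le> 2 * (Gamma \<sigma> / (2 * real (Suc k)) powr \<sigma>)" for k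
      using s Gamma_real_pos[of \<sigma>] by simp
    have "(\<lambda>k. 1 / real (Suc k) powr \<sigma>) sums zeta \<sigma>"
      unfolding zeta_def by (intro summable_sums zeta_summable s)
    then have "(\<lambda>k. Gamma \<sigma> / 2 powr (\<sigma> - 1) * (1 / real (Suc k) powr \<sigma>)) sums K_const \<sigma>"
      unfolding K_const_def by (rule sums_mult)
    moreover have "Gamma \<sigma> / 2 powr (\<sigma> - 1) * (1 / real (Suc k) powr \<sigma>)
        = 2 * (Gamma \<sigma> / (2 * real (Suc k)) powr \<sigma>)" for k
      by (simp add: powr_mult powr_diff del: of_nat_Suc)
    ultimately show "(\<lambda>k. 2 * (Gamma \<sigma> / (2 * real (Suc k)) powr \<sigma>)) sums K_const \<sigma>" by simp
  qed
  finally show ?thesis .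
qed

text \<open>The integral of the kernel with a weight \<open>exp (\<delta> \<bar>ln u\<bar>)\<close> tends to \<^const>\<open>K_const\<close> as \<open>\<delta>\<close> tends
  to \<open>0\<close>. It is finite for one \<open>\<delta> = d\<close>, where the weight is at most \<open>u powr d + u powr (- d)\<close> and
  the exponents \<open>\<sigma> \<plusminus> d\<close> still exceed \<open>1\<close>; convexity of the exponential function bounds it for
  \<open>\<delta> = \<theta> d\<close>.\<close>

lemma kern_exp_integral_close:
  assumes s: "\<sigma> > 1" and k: "K_const \<sigma> < k"
  obtains \<delta> where "0 < \<delta>" "(\<integral>\<^sup>+u. kern \<sigma> u * ennreal (exp (\<delta> * \<bar>ln u\<bar>)) \<partial>haar) < ennreal k"
proof -
  define d where "d = (\<sigma> - 1) / 2"
  have d: "0 < d" "\<sigma> + d > 1" "\<sigma> - d > 1" using s by (auto simp: d_def field_simps)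
  let ?D = "\<lambda>\<delta>. \<integral>\<^sup>+u. kern \<sigma> u * ennreal (exp (\<delta> * \<bar>ln u\<bar>)) \<partial>haar"
  have "?D d \<le> (\<integral>\<^sup>+u. kern (\<sigma> + d) u + kern (\<sigma> - d) u \<partial>haar)"
  proof (rule nn_integral_mono)
    fix u assume "u \<in> space haar"
    then have u: "0 < u" by simp
    have "exp (d * \<bar>ln u\<bar>) \<le> u powr d + u powr (- d)"
      using u by (cases "ln u \<ge> 0") (auto simp: powr_def abs_if)
    then have "(coth u - 1) * u powr \<sigma> * exp (d * \<bar>ln u\<bar>) \<le> (coth u - 1) * u powr \<sigma> * (u powr d + u powr (- d))"
      using coth_gt_1[OF u] by (intro mult_left_mono) auto
    also have "\<dots> = (coth u - 1) * u powr (\<sigma> + d) + (coth u - 1) * u powr (\<sigma> - d)"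
      using powr_add[of u \<sigma> d] powr_add[of u \<sigma> "- d"] by (simp add: distrib_left mult.assoc)
    finally show "kern \<sigma> u * ennreal (exp (d * \<bar>ln u\<bar>)) \<le> kern (\<sigma> + d) u + kern (\<sigma> - d) u"
      unfolding kern_def using coth_gt_1[OF u]
      by (simp flip: ennreal_mult ennreal_plus add: ennreal_leI)
  qed
  also have "\<dots> = ennreal (K_const (\<sigma> + d)) + ennreal (K_const (\<sigma> - d))"
    using d by (simp add: nn_integral_add borel_measurable_haar nn_integral_kern)
  also have "\<dots> < top" by simp
  finally obtain D where D: "?D d = ennreal D" "0 \<le> D" by (cases "?D d") auto
  define \<theta> where "\<theta> = min 1 ((k - K_const \<sigma>) / (D + 1) / 2)"
  have th: "0 < \<theta>" "\<theta> \<le> 1" using k D by (auto simp: \<theta>_def)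
  have "\<theta> * D < k - K_const \<sigma>"
  proof -
    have "\<theta> * (D + 1) \<le> (k - K_const \<sigma>) / (D + 1) / 2 * (D + 1)"
      using D by (intro mult_right_mono) (auto simp: \<theta>_def)
    also have "\<dots> = (k - K_const \<sigma>) / 2" using D(2) by (auto simp: field_simps)
    finally show ?thesis using th k by (simp add: distrib_left)
  qed
  have "?D (\<theta> * d) \<le> (\<integral>\<^sup>+u. kern \<sigma> u + ennreal \<theta> * (kern \<sigma> u * ennreal (exp (d * \<bar>ln u\<bar>))) \<partial>haar)"
  proof (rule nn_integral_mono)
    fix u :: real
    let ?t = "d * \<bar>ln u\<bar>"
    have "exp (\<theta> * ?t) = exp ((1 - \<theta>) *\<^sub>R 0 + \<theta> *\<^sub>R ?t)" by simp
    also have "\<dots> \<le> (1 - \<theta>) * exp 0 + \<theta> * exp ?t"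
      using th by (intro convex_onD[OF exp_convex]) auto
    also have "\<dots> \<le> 1 + \<theta> * exp ?t" using th by simp
    finally have "ennreal (exp (\<theta> * ?t)) \<le> ennreal (1 + \<theta> * exp ?t)" by (rule ennreal_leI)
    also have "\<dots> = 1 + ennreal \<theta> * ennreal (exp ?t)" using th by (simp add: ennreal_mult)
    finally have "kern \<sigma> u * ennreal (exp (\<theta> * d * \<bar>ln u\<bar>)) \<le> kern \<sigma> u * (1 + ennreal \<theta> * ennreal (exp ?t))"
      by (intro mult_left_mono) (auto simp: mult.assoc)
    then show "kern \<sigma> u * ennreal (exp (\<theta> * d * \<bar>ln u\<bar>)) \<le> kern \<sigma> u + ennreal \<theta> * (kern \<sigma> u * ennreal (exp ?t))"
      by (simp add: distrib_left mult_ac)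
  qed
  also have "\<dots> = ennreal (K_const \<sigma>) + ennreal \<theta> * ennreal D"
    using D(1) s by (simp add: nn_integral_add nn_integral_cmult borel_measurable_haar nn_integral_kern)
  also have "\<dots> = ennreal (K_const \<sigma> + \<theta> * D)"
    using th D K_const_pos[OF s] by (simp add: ennreal_mult)
  also have "\<dots> < ennreal k"
    using \<open>\<theta> * D < k - K_const \<sigma>\<close> k K_const_pos[OF s] by (intro ennreal_lessI) auto
  finally show ?thesis using th d that[of "\<theta> * d"] by simp
qed

lemma kern_Icc_integral_close:
  assumes s: "\<sigma> > 1" and k: "k < K_const \<sigma>"
  obtains m :: nat where
    "ennreal k < (\<integral>\<^sup>+u. kern \<sigma> u * indicator {exp (- real m)..exp (real m)} u \<partial>haar)"
proof -
  let ?I = "\<lambda>m::nat. (\<lambda>u. kern \<sigma> u * indicator {exp (- real m)..exp (real m)} u)"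
  have "ennreal k < ennreal (K_const \<sigma>)" using k K_const_pos[OF s] by (intro ennreal_lessI)
  also have "\<dots> = (\<integral>\<^sup>+u. (SUP m. ?I m u) \<partial>haar)"
    unfolding nn_integral_kern[OF s, symmetric]
  proof (rule nn_integral_cong)
    fix u assume "u \<in> space haar"
    then have u: "0 < u" by simp
    obtain m :: nat where "\<bar>ln u\<bar> \<le> real m" using real_arch_simple by blast
    then have m: "exp (- real m) \<le> u" "u \<le> exp (real m)"
      using u exp_le_cancel_iff[of "- real m" "ln u"] exp_le_cancel_iff[of "ln u" "real m"] by auto
    show "kern \<sigma> u = (SUP m. ?I m u)"
      by (intro antisym SUP_least SUP_upper2[of m]) (use m in \<open>auto split: split_indicator\<close>)
  qed
  also have "\<dots> = (SUP m. \<integral>\<^sup>+u. ?I m u \<partial>haar)"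
  proof (intro nn_integral_monotone_convergence_SUP)
    show "incseq ?I"
    proof (intro incseq_SucI le_funI mult_left_mono)
      fix m :: nat and u :: real
      have "{exp (- real m)..exp (real m)} \<subseteq> {exp (- real (Suc m))..exp (real (Suc m))}"
        by (intro atLeastatMost_subset_iff[THEN iffD2] disjI2 conjI) simp_all
      then show "indicator {exp (- real m)..exp (real m)} u
          \<le> (indicator {exp (- real (Suc m))..exp (real (Suc m))} u :: ennreal)"
        by (intro indicator_leI) blast
    qed simp
  qed (auto intro!: borel_measurable_haar)
  finally show ?thesis using that by (auto simp: less_SUP_iff)
qed

section \<open>Strict inequalities for the convolution operator\<close>

text \<open>Convolution with the kernel on the multiplicative group.\<close>

definition kern_conv :: "real \<Rightarrow> (real \<Rightarrow> ennreal) \<Rightarrow> real \<Rightarrow> ennreal" where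
  "kern_conv \<sigma> F y = (\<integral>\<^sup>+x. kern \<sigma> (x / y) * F x \<partial>haar)"

text \<open>The \<open>p\<close>-norm for \<^const>\<open>haar\<close>, for any exponent \<open>p \<noteq> 0\<close>.\<close>

definition haar_norm :: "real \<Rightarrow> (real \<Rightarrow> ennreal) \<Rightarrow> ennreal" where
  "haar_norm p F = epow (\<integral>\<^sup>+x. epow (F x) p \<partial>haar) (1 / p)"

text \<open>The function \<open>x powr a * f x\<close>, whose \<^const>\<open>haar_norm\<close> is a power-weighted norm of \<open>f\<close>.\<close>

definition weighted :: "real \<Rightarrow> (real \<Rightarrow> real) \<Rightarrow> real \<Rightarrow> ennreal" where
  "weighted a f x = ennreal (x powr a * f x)"

lemma kern_pair_measurable [measurable]: "(\<lambda>(x, y). kern \<sigma> (x / y)) \<in> borel_measurable (haar \<Otimes>\<^sub>M haar)"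
proof -
  have [measurable]: "fst \<in> haar \<Otimes>\<^sub>M haar \<rightarrow>\<^sub>M borel" "snd \<in> haar \<Otimes>\<^sub>M haar \<rightarrow>\<^sub>M borel"
    using measurable_compose[OF measurable_fst ident_measurable_haar]
      measurable_compose[OF measurable_snd ident_measurable_haar] by auto
  show ?thesis unfolding case_prod_beta by measurable
qed

lemma kern_conv_measurable [measurable]:
  assumes [measurable]: "F \<in> borel_measurable haar"
  shows "kern_conv \<sigma> F \<in> borel_measurable haar"
proof -
  interpret sigma_finite_measure haar by (rule sigma_finite_haar)
  show ?thesis unfolding kern_conv_def by measurable
qed

lemma haar_norm_pos_finite_iff:
  "p \<noteq> 0 \<Longrightarrow> 0 < haar_norm p F \<and> haar_norm p F < \<infinity> \<longleftrightarrow>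
     0 < (\<integral>\<^sup>+x. epow (F x) p \<partial>haar) \<and> (\<integral>\<^sup>+x. epow (F x) p \<partial>haar) < \<infinity>"
  unfolding haar_norm_def by (intro epow_pos_finite_iff) simp

lemma haar_norm_cmult:
  assumes [measurable]: "F \<in> borel_measurable haar" and "0 < c" "p \<noteq> 0"
  shows "haar_norm p (\<lambda>x. ennreal c * F x) = ennreal c * haar_norm p F"
proof -
  have "haar_norm p (\<lambda>x. ennreal c * F x) = epow (ennreal (c powr p) * (\<integral>\<^sup>+x. epow (F x) p \<partial>haar)) (1 / p)"
    using assms by (simp add: haar_norm_def epow_cmult nn_integral_cmult)
  also have "\<dots> = ennreal c * haar_norm p F"
    using assms by (simp add: haar_norm_def epow_cmult powr_powr)
  finally show ?thesis .
qed

text \<open>For \<open>p < 0\<close> both the power and the root reverse the order.\<close>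

lemma haar_norm_mono:
  assumes "\<And>x. 0 < x \<Longrightarrow> F x \<le> G x" "p \<noteq> 0"
  shows "haar_norm p F \<le> haar_norm p G"
proof (cases "p > 0")
  case True
  then show ?thesis unfolding haar_norm_def
    using assms by (intro epow_mono nn_integral_mono) auto
next
  case False
  then show ?thesis unfolding haar_norm_def
    using assms by (intro epow_antimono nn_integral_mono) auto
qed

lemma kern_first: "0 < y \<Longrightarrow> \<sigma> > 1 \<Longrightarrow> (\<integral>\<^sup>+x. kern \<sigma> (x / y) \<partial>haar) = ennreal (K_const \<sigma>)"
  using nn_integral_haar_scale[of "kern \<sigma>" y] by (simp add: nn_integral_kern)

lemma kern_second: "0 < x \<Longrightarrow> \<sigma> > 1 \<Longrightarrow> (\<integral>\<^sup>+y. kern \<sigma> (x / y) \<partial>haar) = ennreal (K_const \<sigma>)"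
  using nn_integral_haar_invert[of "kern \<sigma>" x] by (simp add: nn_integral_kern)

text \<open>The comparison of norms for the kernel divided by \<^const>\<open>K_const\<close>, before taking roots.\<close>

lemma kern_conv_norm_aux:
  assumes s: "\<sigma> > 1" and F [measurable]: "F \<in> borel_measurable haar" and p: "p \<noteq> 0" "p \<noteq> 1"
    and nF: "0 < haar_norm p F" "haar_norm p F < \<infinity>"
  defines "a \<equiv> \<integral>\<^sup>+x. epow (F x) p \<partial>haar"
    and "J \<equiv> \<integral>\<^sup>+y. epow (ennreal (1 / K_const \<sigma>) * kern_conv \<sigma> F y) p \<partial>haar"
  shows "if 0 < p \<and> p < 1 then a < J else J < a"
proof -
  define H where "H = (\<lambda>x y. ennreal (1 / K_const \<sigma>) * kern \<sigma> (x / y))"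
  have K: "0 < K_const \<sigma>" by (rule K_const_pos[OF s])
  have meas: "(\<lambda>(x, y). H x y) \<in> borel_measurable (haar \<Otimes>\<^sub>M haar)"
    unfolding H_def by (simp add: case_prod_beta')
  have pos: "0 < H x y" if "x \<in> space haar" "y \<in> space haar" for x y
    using that K kern_pos[of "x / y" \<sigma>] by (simp add: H_def ennreal_zero_less_mult_iff)
  have KK: "ennreal (1 / K_const \<sigma>) * ennreal (K_const \<sigma>) = 1"
    using K by (simp flip: ennreal_mult)
  have first: "(\<integral>\<^sup>+x. H x y \<partial>haar) = 1" if "y \<in> space haar" for y
    using that s by (simp add: H_def nn_integral_cmult borel_measurable_haar kern_first KK)
  have second: "(\<integral>\<^sup>+y. H x y \<partial>haar) = 1" if "x \<in> space haar" for x
    using that s by (simp add: H_def nn_integral_cmult borel_measurable_haar kern_second KK)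
  have a: "0 < a" "a < top"
    using nF haar_norm_pos_finite_iff[OF p(1), of F] by (auto simp: a_def)
  have "(\<integral>\<^sup>+x. H x y * F x \<partial>haar) = ennreal (1 / K_const \<sigma>) * kern_conv \<sigma> F y" for y
    unfolding kern_conv_def H_def mult.assoc
    by (rule nn_integral_cmult) (rule borel_measurable_times_ennreal[OF borel_measurable_haar F], simp)
  then have J: "J = (\<integral>\<^sup>+y. epow (\<integral>\<^sup>+x. H x y * F x \<partial>haar) p \<partial>haar)" by (simp add: J_def)
  show ?thesis
    using markov_norm_less[OF sigma_finite_haar emeasure_haar_space meas pos first second F, of p]
      markov_norm_greater[OF sigma_finite_haar emeasure_haar_space meas pos first second F, of p] a p
    unfolding J a_def by auto
qed

lemma kern_conv_norm:
  assumes s: "\<sigma> > 1" and F [measurable]: "F \<in> borel_measurable haar" and p: "p \<noteq> 0" "p \<noteq> 1"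
    and nF: "0 < haar_norm p F" "haar_norm p F < \<infinity>"
  shows "p > 1 \<Longrightarrow> haar_norm p (kern_conv \<sigma> F) < ennreal (K_const \<sigma>) * haar_norm p F"
    and "p < 1 \<Longrightarrow> ennreal (K_const \<sigma>) * haar_norm p F < haar_norm p (kern_conv \<sigma> F)"
proof -
  have K: "0 < K_const \<sigma>" by (rule K_const_pos[OF s])
  let ?F = "\<lambda>y. ennreal (1 / K_const \<sigma>) * kern_conv \<sigma> F y"
  have "ennreal (K_const \<sigma>) * ennreal (1 / K_const \<sigma>) = 1"
    using K by (simp flip: ennreal_mult)
  then have "kern_conv \<sigma> F = (\<lambda>y. ennreal (K_const \<sigma>) * ?F y)"
    by (simp add: fun_eq_iff flip: mult.assoc)
  then have "haar_norm p (kern_conv \<sigma> F) = haar_norm p (\<lambda>y. ennreal (K_const \<sigma>) * ?F y)" by simp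
  also have "\<dots> = ennreal (K_const \<sigma>) * haar_norm p ?F"
    using K p by (intro haar_norm_cmult) auto
  finally have eq: "haar_norm p (kern_conv \<sigma> F) = ennreal (K_const \<sigma>) * haar_norm p ?F" .
  note aux = kern_conv_norm_aux[OF s F p nF]
  show "haar_norm p (kern_conv \<sigma> F) < ennreal (K_const \<sigma>) * haar_norm p F" if "p > 1"
  proof -
    have "haar_norm p ?F < haar_norm p F"
      unfolding haar_norm_def using aux that by (intro epow_strict_mono) auto
    then show ?thesis unfolding eq using K by (intro ennreal_mult_strict_left_mono) auto
  qed
  show "ennreal (K_const \<sigma>) * haar_norm p F < haar_norm p (kern_conv \<sigma> F)" if "p < 1"
  proof -
    have "haar_norm p F < haar_norm p ?F"
    proof (cases "p > 0")
      case True
      then show ?thesis unfolding haar_norm_def using aux that by (intro epow_strict_mono) auto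
    next
      case False
      then show ?thesis unfolding haar_norm_def using aux p by (intro epow_strict_antimono) auto
    qed
    then show ?thesis unfolding eq using K by (intro ennreal_mult_strict_left_mono) auto
  qed
qed

lemma kern_conv_bilinear:
  assumes s: "\<sigma> > 1" and F [measurable]: "F \<in> borel_measurable haar" and G [measurable]: "G \<in> borel_measurable haar"
    and p: "p \<noteq> 0" "p \<noteq> 1" and pq: "1 / p + 1 / q = 1"
    and nF: "0 < haar_norm p F" "haar_norm p F < \<infinity>" and nG: "0 < haar_norm q G" "haar_norm q G < \<infinity>"
  defines "I \<equiv> \<integral>\<^sup>+y. kern_conv \<sigma> F y * G y \<partial>haar"
  shows "p > 1 \<Longrightarrow> I < ennreal (K_const \<sigma>) * haar_norm p F * haar_norm q G"
    and "p < 1 \<Longrightarrow> ennreal (K_const \<sigma>) * haar_norm p F * haar_norm q G < I"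
proof -
  have K: "0 < K_const \<sigma>" by (rule K_const_pos[OF s])
  have q: "q \<noteq> 0" using pq p by auto
  obtain A where A: "(\<integral>\<^sup>+x. epow (F x) p \<partial>haar) = ennreal A" "0 < A"
    using nF haar_norm_pos_finite_iff[OF p(1), of F]
    by (cases "\<integral>\<^sup>+x. epow (F x) p \<partial>haar" rule: ennreal_zero_pos_top_cases) auto
  obtain B where B: "(\<integral>\<^sup>+x. epow (G x) q \<partial>haar) = ennreal B" "0 < B"
    using nG haar_norm_pos_finite_iff[OF q, of G]
    by (cases "\<integral>\<^sup>+x. epow (G x) q \<partial>haar" rule: ennreal_zero_pos_top_cases) auto
  \<comment> \<open>dividing \<open>F\<close>, \<open>G\<close> and the kernel by their norms turns the right-hand side into \<open>1\<close>\<close>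
  define c where "c = A powr (- 1 / p) * (1 / K_const \<sigma>) * B powr (- 1 / q)"
  have c: "0 < c" using A B K by (simp add: c_def)
  let ?S = "\<lambda>y. ennreal (1 / K_const \<sigma>) * kern_conv \<sigma> F y"
  let ?S' = "\<lambda>y. ennreal (A powr (- 1 / p)) * ?S y" and ?G' = "\<lambda>y. ennreal (B powr (- 1 / q)) * G y"
  have cI: "(\<integral>\<^sup>+y. ?S' y * ?G' y \<partial>haar) = ennreal c * I"
  proof -
    have "ennreal c = ennreal (A powr (- 1 / p)) * ennreal (1 / K_const \<sigma>) * ennreal (B powr (- 1 / q))"
      unfolding c_def using K by (subst ennreal_mult, simp, simp)+ simp
    then have "(\<lambda>y. ?S' y * ?G' y) = (\<lambda>y. ennreal c * (kern_conv \<sigma> F y * G y))"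
      by (simp add: fun_eq_iff mult_ac)
    then show ?thesis by (simp add: I_def nn_integral_cmult)
  qed
  have rhs: "ennreal c * (ennreal (K_const \<sigma>) * haar_norm p F * haar_norm q G) = 1"
  proof -
    have "ennreal (K_const \<sigma>) * haar_norm p F * haar_norm q G
        = ennreal (K_const \<sigma> * A powr (1 / p) * B powr (1 / q))"
      using A B K by (simp add: haar_norm_def epow_ennreal ennreal_mult)
    moreover have "c * (K_const \<sigma> * A powr (1 / p) * B powr (1 / q)) = 1"
      using A(2) B(2) K unfolding c_def by (simp add: powr_minus divide_simps)
    moreover have "ennreal c * ennreal (K_const \<sigma> * A powr (1 / p) * B powr (1 / q))
        = ennreal (c * (K_const \<sigma> * A powr (1 / p) * B powr (1 / q)))"
      using c K by (intro ennreal_mult[symmetric]) auto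
    ultimately show ?thesis by simp
  qed
  have cancel: "x < y" if "ennreal c * x < ennreal c * y" for x y
    using that by (meson mult_left_mono not_le zero_le)
  have J: "(\<integral>\<^sup>+y. epow (?S' y) p \<partial>haar) = ennreal (1 / A) * (\<integral>\<^sup>+y. epow (?S y) p \<partial>haar)"
    using A p by (intro nn_integral_epow_scaled) auto
  have G1: "(\<integral>\<^sup>+y. epow (?G' y) q \<partial>haar) = 1"
    using B q by (subst nn_integral_epow_scaled) (auto simp flip: ennreal_mult)
  have S': "?S' \<in> borel_measurable haar" and G': "?G' \<in> borel_measurable haar" by measurable
  note aux = kern_conv_norm_aux[OF s F p nF, unfolded A]
  note holder = holder_normalised[OF S' G' pq p G1, unfolded J cI]
  show "I < ennreal (K_const \<sigma>) * haar_norm p F * haar_norm q G" if "p > 1"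
  proof (rule cancel)
    have "ennreal c * I < 1"
      using aux that A by (intro holder(1) ennreal_inverse_mult_less_1) auto
    then show "ennreal c * I < ennreal c * (ennreal (K_const \<sigma>) * haar_norm p F * haar_norm q G)"
      unfolding rhs .
  qed
  show "ennreal (K_const \<sigma>) * haar_norm p F * haar_norm q G < I" if "p < 1"
  proof (rule cancel)
    have "1 < ennreal c * I"
    proof (cases "p > 0")
      case True
      then show ?thesis using aux that A by (intro holder(2) ennreal_inverse_mult_gt_1) auto
    next
      case False
      then show ?thesis using aux p A by (intro holder(3) ennreal_inverse_mult_less_1) auto
    qed
    then show "ennreal c * (ennreal (K_const \<sigma>) * haar_norm p F * haar_norm q G) < ennreal c * I"
      unfolding rhs .
  qed
qed

section \<open>The four inequalities in terms of convolution\<close>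

lemma weighted_measurable:
  assumes "f \<in> borel_measurable Rpos"
  shows "weighted a f \<in> borel_measurable haar"
proof -
  have [measurable]: "(\<lambda>x. x powr a) \<in> borel_measurable Rpos"
    by (intro borel_measurable_Rpos) simp
  show ?thesis unfolding weighted_def measurable_haar_iff using assms by measurable
qed

lemma weighted_eq:
  assumes "0 < x" "0 \<le> f x"
  shows "weighted a f x = ennreal (x powr a) * ennreal (f x)"
  unfolding weighted_def using assms by (intro ennreal_mult) auto

lemma wnorm_powr_weight:
  assumes f: "f \<in> borel_measurable Rpos" "\<forall>x>0. 0 \<le> f x"
  shows "wnorm r (\<lambda>x. x powr (r * a - 1)) f = haar_norm r (weighted a f)"
proof -
  note [measurable] = weighted_measurable[OF f(1), of a, unfolded measurable_haar_iff]
  have "(\<integral>\<^sup>+x. epow (weighted a f x) r \<partial>haar)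
      = (\<integral>\<^sup>+x. ennreal (1 / x) * epow (weighted a f x) r \<partial>Rpos)"
    by (intro nn_integral_haar) measurable
  also have "\<dots> = (\<integral>\<^sup>+x. ennreal (x powr (r * a - 1)) * epow (ennreal (f x)) r \<partial>Rpos)"
  proof (rule nn_integral_cong)
    fix x assume "x \<in> space Rpos"
    then have x: "0 < x" by simp
    have "ennreal (1 / x) * epow (weighted a f x) r
        = (ennreal (1 / x) * ennreal ((x powr a) powr r)) * epow (ennreal (f x)) r"
      using x f(2) by (simp add: weighted_eq epow_cmult mult.assoc)
    also have "ennreal (1 / x) * ennreal ((x powr a) powr r) = ennreal (1 / x * (x powr a) powr r)"
      using x by (intro ennreal_mult[symmetric]) auto
    also have "1 / x * (x powr a) powr r = x powr (r * a - 1)"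
      using x by (simp add: powr_powr powr_diff mult.commute)
    finally show "ennreal (1 / x) * epow (weighted a f x) r
        = ennreal (x powr (r * a - 1)) * epow (ennreal (f x)) r" .
  qed
  finally show ?thesis by (simp add: wnorm_def haar_norm_def)
qed

lemma wnorm_phi:
  assumes "f \<in> borel_measurable Rpos" "\<forall>x>0. 0 \<le> f x"
  shows "wnorm p (phi p \<sigma>) f = haar_norm p (weighted (1 - \<sigma>) f)"
  using wnorm_powr_weight[OF assms] by (simp add: phi_def[abs_def])

lemma wnorm_psi:
  assumes "f \<in> borel_measurable Rpos" "\<forall>x>0. 0 \<le> f x"
  shows "wnorm q (psi q \<sigma>) f = haar_norm q (weighted (1 + \<sigma>) f)"
  using wnorm_powr_weight[OF assms] by (simp add: psi_def[abs_def])

lemma kern_integral_eq_conv: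
  assumes f: "f \<in> borel_measurable Rpos" "\<forall>x>0. 0 \<le> f x" and y: "0 < y"
  shows "(\<integral>\<^sup>+x. ennreal ((coth (x / y) - 1) * f x) \<partial>Rpos)
    = ennreal (y powr \<sigma>) * kern_conv \<sigma> (weighted (1 - \<sigma>) f) y"
proof -
  have [measurable]: "(\<lambda>x. coth (x / y)) \<in> borel_measurable Rpos"
    by (intro borel_measurable_Rpos) measurable
  note [measurable] = f(1)
  have "(\<integral>\<^sup>+x. ennreal ((coth (x / y) - 1) * f x) \<partial>Rpos)
      = (\<integral>\<^sup>+x. ennreal x * ennreal ((coth (x / y) - 1) * f x) \<partial>haar)"
    by (intro nn_integral_Rpos_eq_haar) measurable
  also have "\<dots> = (\<integral>\<^sup>+x. ennreal (y powr \<sigma>) * (kern \<sigma> (x / y) * weighted (1 - \<sigma>) f x) \<partial>haar)"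
  proof (rule nn_integral_cong)
    fix x assume "x \<in> space haar"
    then have x: "0 < x" by simp
    have c: "0 \<le> coth (x / y) - 1" using coth_gt_1[of "x / y"] x y by simp
    have "x * ((coth (x / y) - 1) * f x)
        = y powr \<sigma> * (((coth (x / y) - 1) * (x / y) powr \<sigma>) * (x powr (1 - \<sigma>) * f x))"
      using x y by (simp add: powr_divide powr_diff)
    then show "ennreal x * ennreal ((coth (x / y) - 1) * f x)
        = ennreal (y powr \<sigma>) * (kern \<sigma> (x / y) * weighted (1 - \<sigma>) f x)"
      unfolding kern_def weighted_def using x y c f(2)[rule_format, OF x] by (simp flip: ennreal_mult)
  qed
  also have "\<dots> = ennreal (y powr \<sigma>) * kern_conv \<sigma> (weighted (1 - \<sigma>) f) y"
    unfolding kern_conv_def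
    by (rule nn_integral_cmult)
      (rule borel_measurable_times_ennreal[OF borel_measurable_haar weighted_measurable[OF f(1)]], simp)
  finally show ?thesis .
qed

lemma kern_integral_measurable:
  assumes f: "f \<in> borel_measurable Rpos" "\<forall>x>0. 0 \<le> f x"
  shows "(\<lambda>y. \<integral>\<^sup>+x. ennreal ((coth (x / y) - 1) * f x) \<partial>Rpos) \<in> borel_measurable Rpos"
proof -
  note [measurable] = kern_conv_measurable[OF weighted_measurable[OF f(1)], unfolded measurable_haar_iff]
  have [measurable]: "(\<lambda>y. y powr 1) \<in> borel_measurable Rpos"
    by (intro borel_measurable_Rpos) measurable
  \<comment> \<open>the integral does not involve the exponent of the kernel, so any value, here \<open>1\<close>, will do\<close>
  have "(\<lambda>y. ennreal (y powr 1) * kern_conv 1 (weighted (1 - 1) f) y) \<in> borel_measurable Rpos"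
    by measurable
  then show ?thesis
    by (rule measurable_cong[THEN iffD2, rotated]) (use kern_integral_eq_conv[OF f, of _ 1] in auto)
qed

lemma kern_double_integral:
  assumes f: "f \<in> borel_measurable Rpos" "\<forall>x>0. 0 \<le> f x"
    and g: "g \<in> borel_measurable Rpos" "\<forall>x>0. 0 \<le> g x"
  shows "(\<integral>\<^sup>+y. (\<integral>\<^sup>+x. ennreal ((coth (x / y) - 1) * f x * g y) \<partial>Rpos) \<partial>Rpos)
      = (\<integral>\<^sup>+y. (\<integral>\<^sup>+x. ennreal ((coth (x / y) - 1) * f x) \<partial>Rpos) * ennreal (g y) \<partial>Rpos)"
    and "(\<integral>\<^sup>+y. (\<integral>\<^sup>+x. ennreal ((coth (x / y) - 1) * f x * g y) \<partial>Rpos) \<partial>Rpos)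
      = (\<integral>\<^sup>+y. kern_conv \<sigma> (weighted (1 - \<sigma>) f) y * weighted (1 + \<sigma>) g y \<partial>haar)"
proof -
  note [measurable] = f(1) g(1) kern_integral_measurable[OF f]
  show eq: "(\<integral>\<^sup>+y. (\<integral>\<^sup>+x. ennreal ((coth (x / y) - 1) * f x * g y) \<partial>Rpos) \<partial>Rpos)
      = (\<integral>\<^sup>+y. (\<integral>\<^sup>+x. ennreal ((coth (x / y) - 1) * f x) \<partial>Rpos) * ennreal (g y) \<partial>Rpos)"
  proof (rule nn_integral_cong)
    fix y assume "y \<in> space Rpos"
    then have y: "0 < y" by simp
    have [measurable]: "(\<lambda>x. coth (x / y)) \<in> borel_measurable Rpos"
      by (intro borel_measurable_Rpos) measurable
    have "(\<integral>\<^sup>+x. ennreal ((coth (x / y) - 1) * f x * g y) \<partial>Rpos)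
        = (\<integral>\<^sup>+x. ennreal ((coth (x / y) - 1) * f x) * ennreal (g y) \<partial>Rpos)"
      using g(2)[rule_format, OF y] by (intro nn_integral_cong ennreal_mult'')
    also have "\<dots> = (\<integral>\<^sup>+x. ennreal ((coth (x / y) - 1) * f x) \<partial>Rpos) * ennreal (g y)"
      by (intro nn_integral_multc) measurable
    finally show "(\<integral>\<^sup>+x. ennreal ((coth (x / y) - 1) * f x * g y) \<partial>Rpos)
        = (\<integral>\<^sup>+x. ennreal ((coth (x / y) - 1) * f x) \<partial>Rpos) * ennreal (g y)" .
  qed
  also have "\<dots> = (\<integral>\<^sup>+y. ennreal y * ((\<integral>\<^sup>+x. ennreal ((coth (x / y) - 1) * f x) \<partial>Rpos) * ennreal (g y)) \<partial>haar)"
    by (intro nn_integral_Rpos_eq_haar) measurable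
  also have "\<dots> = (\<integral>\<^sup>+y. kern_conv \<sigma> (weighted (1 - \<sigma>) f) y * weighted (1 + \<sigma>) g y \<partial>haar)"
  proof (rule nn_integral_cong)
    fix y assume "y \<in> space haar"
    then have y: "0 < y" by simp
    have "ennreal y * ((\<integral>\<^sup>+x. ennreal ((coth (x / y) - 1) * f x) \<partial>Rpos) * ennreal (g y))
        = kern_conv \<sigma> (weighted (1 - \<sigma>) f) y * ((ennreal y * ennreal (y powr \<sigma>)) * ennreal (g y))"
      unfolding kern_integral_eq_conv[OF f y, of \<sigma>] by (simp only: mult_ac)
    also have "ennreal y * ennreal (y powr \<sigma>) = ennreal (y powr (1 + \<sigma>))"
      using y by (simp add: powr_add flip: ennreal_mult)
    also have "ennreal (y powr (1 + \<sigma>)) * ennreal (g y) = weighted (1 + \<sigma>) g y"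
      using weighted_eq[of y g, OF y g(2)[rule_format, OF y]] by simp
    finally show "ennreal y * ((\<integral>\<^sup>+x. ennreal ((coth (x / y) - 1) * f x) \<partial>Rpos) * ennreal (g y))
        = kern_conv \<sigma> (weighted (1 - \<sigma>) f) y * weighted (1 + \<sigma>) g y" .
  qed
  finally show "(\<integral>\<^sup>+y. (\<integral>\<^sup>+x. ennreal ((coth (x / y) - 1) * f x * g y) \<partial>Rpos) \<partial>Rpos)
      = (\<integral>\<^sup>+y. kern_conv \<sigma> (weighted (1 - \<sigma>) f) y * weighted (1 + \<sigma>) g y \<partial>haar)" .
qed

lemma kern_integral_norm:
  assumes f: "f \<in> borel_measurable Rpos" "\<forall>x>0. 0 \<le> f x"
  shows "epow (\<integral>\<^sup>+y. ennreal (y powr (- p * \<sigma> - 1)) *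
            epow (\<integral>\<^sup>+x. ennreal ((coth (x / y) - 1) * f x) \<partial>Rpos) p \<partial>Rpos) (1 / p)
      = haar_norm p (kern_conv \<sigma> (weighted (1 - \<sigma>) f))"
proof -
  let ?T = "kern_conv \<sigma> (weighted (1 - \<sigma>) f)"
  note [measurable] = kern_conv_measurable[OF weighted_measurable[OF f(1)], unfolded measurable_haar_iff]
  have "(\<integral>\<^sup>+y. epow (?T y) p \<partial>haar) = (\<integral>\<^sup>+y. ennreal (1 / y) * epow (?T y) p \<partial>Rpos)"
    by (intro nn_integral_haar) measurable
  also have "\<dots> = (\<integral>\<^sup>+y. ennreal (y powr (- p * \<sigma> - 1)) *
            epow (\<integral>\<^sup>+x. ennreal ((coth (x / y) - 1) * f x) \<partial>Rpos) p \<partial>Rpos)"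
  proof (rule nn_integral_cong)
    fix y assume "y \<in> space Rpos"
    then have y: "0 < y" by simp
    have "ennreal (y powr (- p * \<sigma> - 1)) * epow (\<integral>\<^sup>+x. ennreal ((coth (x / y) - 1) * f x) \<partial>Rpos) p
        = (ennreal (y powr (- p * \<sigma> - 1)) * ennreal ((y powr \<sigma>) powr p)) * epow (?T y) p"
      using y by (simp only: kern_integral_eq_conv[OF f y, of \<sigma>]) (simp add: epow_cmult mult.assoc)
    also have "ennreal (y powr (- p * \<sigma> - 1)) * ennreal ((y powr \<sigma>) powr p)
        = ennreal (y powr (- p * \<sigma> - 1) * (y powr \<sigma>) powr p)"
      by (intro ennreal_mult[symmetric]) auto
    also have "y powr (- p * \<sigma> - 1) * (y powr \<sigma>) powr p = y powr (- p * \<sigma> - 1 + \<sigma> * p)"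
      by (simp only: powr_powr powr_add)
    also have "- p * \<sigma> - 1 + \<sigma> * p = - 1" by simp
    also have "y powr (- 1) = 1 / y" using y by (simp add: powr_minus_divide)
    finally show "ennreal (1 / y) * epow (?T y) p = ennreal (y powr (- p * \<sigma> - 1)) *
            epow (\<integral>\<^sup>+x. ennreal ((coth (x / y) - 1) * f x) \<partial>Rpos) p" by simp
  qed
  finally show ?thesis by (simp add: haar_norm_def)
qed

lemma coth_integral_eq:
  assumes f: "f \<in> borel_measurable Rpos" "\<forall>x>0. 0 \<le> f x" and y: "0 < y"
  shows "(\<integral>\<^sup>+x. ennreal (coth (x / y) * f x) \<partial>Rpos)
    = l1norm f + (\<integral>\<^sup>+x. ennreal ((coth (x / y) - 1) * f x) \<partial>Rpos)"
proof -
  note [measurable] = f(1)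
  have [measurable]: "(\<lambda>x. coth (x / y)) \<in> borel_measurable Rpos"
    by (intro borel_measurable_Rpos) measurable
  have "(\<integral>\<^sup>+x. ennreal (coth (x / y) * f x) \<partial>Rpos)
      = (\<integral>\<^sup>+x. ennreal (f x) + ennreal ((coth (x / y) - 1) * f x) \<partial>Rpos)"
  proof (rule nn_integral_cong)
    fix x assume "x \<in> space Rpos"
    then have x: "0 < x" by simp
    have "coth (x / y) * f x = f x + (coth (x / y) - 1) * f x" by (simp add: algebra_simps)
    moreover have "0 \<le> (coth (x / y) - 1) * f x"
      using coth_gt_1[of "x / y"] x y f(2)[rule_format, OF x] by simp
    ultimately show "ennreal (coth (x / y) * f x) = ennreal (f x) + ennreal ((coth (x / y) - 1) * f x)"
      using f(2)[rule_format, OF x] by (simp only: ennreal_plus)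
  qed
  then show ?thesis by (simp add: nn_integral_add l1norm_def)
qed

lemma coth_double_integral_eq:
  assumes f: "f \<in> borel_measurable Rpos" "\<forall>x>0. 0 \<le> f x"
    and g: "g \<in> borel_measurable Rpos" "\<forall>x>0. 0 \<le> g x"
  shows "(\<integral>\<^sup>+y. (\<integral>\<^sup>+x. ennreal (coth (x / y) * f x * g y) \<partial>Rpos) \<partial>Rpos)
      = l1norm f * l1norm g
        + (\<integral>\<^sup>+y. (\<integral>\<^sup>+x. ennreal ((coth (x / y) - 1) * f x * g y) \<partial>Rpos) \<partial>Rpos)"
proof -
  note [measurable] = f(1) g(1) kern_integral_measurable[OF f]
  have "(\<integral>\<^sup>+y. (\<integral>\<^sup>+x. ennreal (coth (x / y) * f x * g y) \<partial>Rpos) \<partial>Rpos)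
      = (\<integral>\<^sup>+y. l1norm f * ennreal (g y) + (\<integral>\<^sup>+x. ennreal ((coth (x / y) - 1) * f x) \<partial>Rpos) * ennreal (g y) \<partial>Rpos)"
  proof (rule nn_integral_cong)
    fix y assume "y \<in> space Rpos"
    then have y: "0 < y" by simp
    have [measurable]: "(\<lambda>x. coth (x / y)) \<in> borel_measurable Rpos"
      by (intro borel_measurable_Rpos) measurable
    have "(\<integral>\<^sup>+x. ennreal (coth (x / y) * f x * g y) \<partial>Rpos)
        = (\<integral>\<^sup>+x. ennreal (coth (x / y) * f x) * ennreal (g y) \<partial>Rpos)"
      using g(2)[rule_format, OF y] by (intro nn_integral_cong ennreal_mult'')
    also have "\<dots> = (\<integral>\<^sup>+x. ennreal (coth (x / y) * f x) \<partial>Rpos) * ennreal (g y)"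
      by (intro nn_integral_multc) measurable
    finally show "(\<integral>\<^sup>+x. ennreal (coth (x / y) * f x * g y) \<partial>Rpos)
        = l1norm f * ennreal (g y) + (\<integral>\<^sup>+x. ennreal ((coth (x / y) - 1) * f x) \<partial>Rpos) * ennreal (g y)"
      by (simp add: coth_integral_eq[OF f y] distrib_right)
  qed
  also have "\<dots> = l1norm f * l1norm g
      + (\<integral>\<^sup>+y. (\<integral>\<^sup>+x. ennreal ((coth (x / y) - 1) * f x) \<partial>Rpos) * ennreal (g y) \<partial>Rpos)"
    by (simp add: nn_integral_add nn_integral_cmult l1norm_def[of g])
  finally show ?thesis unfolding kern_double_integral(1)[OF f g] .
qed

lemma admD:
  assumes "f \<in> adm r w"
  shows "f \<in> borel_measurable Rpos" "\<forall>x>0. 0 \<le> f x" "0 < wnorm r w f" "wnorm r w f < \<infinity>"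
  using assms by (auto simp: adm_def)

lemma adm1D:
  assumes "f \<in> adm1 r w"
  shows "f \<in> adm r w" "0 < l1norm f" "l1norm f < \<infinity>"
  using assms by (auto simp: adm1_def)

text \<open>The product \<open>\<parallel>f\<parallel> \<parallel>g\<parallel>\<close> is finite and cancels.\<close>

lemma ineq_C_iff:
  assumes R: "R = (<) \<or> R = (>)"
  shows "ineq_C R p q \<sigma> c \<longleftrightarrow>
    (\<forall>f \<in> adm1 p (phi p \<sigma>). \<forall>g \<in> adm1 q (psi q \<sigma>).
      R (\<integral>\<^sup>+y. (\<integral>\<^sup>+x. ennreal ((coth (x / y) - 1) * f x * g y) \<partial>Rpos) \<partial>Rpos)
        (ennreal c * wnorm p (phi p \<sigma>) f * wnorm q (psi q \<sigma>) g))"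
  unfolding ineq_C_def
proof (intro ball_cong refl)
  fix f g assume f: "f \<in> adm1 p (phi p \<sigma>)" and g: "g \<in> adm1 q (psi q \<sigma>)"
  note fD = adm1D[OF f] and gD = adm1D[OF g]
  have cancel: "R (u + a) (u + b) \<longleftrightarrow> R a b" if "u < \<infinity>" for u a b :: ennreal
    using that R by (auto simp: ennreal_add_left_cancel_less)
  have fin: "l1norm f * l1norm g < \<infinity>"
    using fD(3) gD(3) by (simp add: ennreal_mult_less_top)
  show "R (\<integral>\<^sup>+y. (\<integral>\<^sup>+x. ennreal (coth (x / y) * f x * g y) \<partial>Rpos) \<partial>Rpos)
      (l1norm f * l1norm g + ennreal c * wnorm p (phi p \<sigma>) f * wnorm q (psi q \<sigma>) g)
    \<longleftrightarrow> R (\<integral>\<^sup>+y. (\<integral>\<^sup>+x. ennreal ((coth (x / y) - 1) * f x * g y) \<partial>Rpos) \<partial>Rpos)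
      (ennreal c * wnorm p (phi p \<sigma>) f * wnorm q (psi q \<sigma>) g)"
    unfolding coth_double_integral_eq[OF admD(1,2)[OF fD(1)] admD(1,2)[OF gD(1)]] cancel[OF fin] ..
qed

lemma ineq_A_imp_ineq_C:
  assumes "R = (<) \<or> R = (>)" "ineq_A R p q \<sigma> c" shows "ineq_C R p q \<sigma> c"
  using assms(2) adm1D(1) unfolding ineq_C_iff[OF assms(1)] ineq_A_def by blast

lemma ineq_D_integral_eq:
  assumes "f \<in> adm1 p (phi p \<sigma>)"
  shows "(\<integral>\<^sup>+y. ennreal (y powr (- p * \<sigma> - 1)) *
      epow ((\<integral>\<^sup>+x. ennreal (coth (x / y) * f x) \<partial>Rpos) - l1norm f) p \<partial>Rpos)
    = (\<integral>\<^sup>+y. ennreal (y powr (- p * \<sigma> - 1)) *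
      epow (\<integral>\<^sup>+x. ennreal ((coth (x / y) - 1) * f x) \<partial>Rpos) p \<partial>Rpos)"
proof (rule nn_integral_cong)
  fix y assume "y \<in> space Rpos"
  then have y: "0 < y" by simp
  have "(\<integral>\<^sup>+x. ennreal (coth (x / y) * f x) \<partial>Rpos) - l1norm f
      = (\<integral>\<^sup>+x. ennreal ((coth (x / y) - 1) * f x) \<partial>Rpos)"
    using adm1D[OF assms] y by (simp add: coth_integral_eq admD(1,2))
  then show "ennreal (y powr (- p * \<sigma> - 1)) *
      epow ((\<integral>\<^sup>+x. ennreal (coth (x / y) * f x) \<partial>Rpos) - l1norm f) p
    = ennreal (y powr (- p * \<sigma> - 1)) *
      epow (\<integral>\<^sup>+x. ennreal ((coth (x / y) - 1) * f x) \<partial>Rpos) p" by simp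
qed

lemma ineq_B_imp_ineq_D:
  assumes "ineq_B R p \<sigma> c" shows "ineq_D R p \<sigma> c"
  unfolding ineq_D_def
proof
  fix f assume f: "f \<in> adm1 p (phi p \<sigma>)"
  then show "R (epow (\<integral>\<^sup>+y. ennreal (y powr (- p * \<sigma> - 1)) *
      epow ((\<integral>\<^sup>+x. ennreal (coth (x / y) * f x) \<partial>Rpos) - l1norm f) p \<partial>Rpos) (1 / p))
    (ennreal c * wnorm p (phi p \<sigma>) f)"
    unfolding ineq_D_integral_eq[OF f] using assms adm1D(1)[OF f] by (simp only: ineq_B_def)
qed

lemma ineq_A_K_const:
  assumes "\<sigma> > 1" "p \<noteq> 0" "p \<noteq> 1" "1 / p + 1 / q = 1"
  shows "p > 1 \<Longrightarrow> ineq_A (<) p q \<sigma> (K_const \<sigma>)"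
    and "p < 1 \<Longrightarrow> ineq_A (>) p q \<sigma> (K_const \<sigma>)"
proof -
  let ?F = "weighted (1 - \<sigma>)" and ?G = "weighted (1 + \<sigma>)"
  have *: "(p > 1 \<longrightarrow> (\<integral>\<^sup>+y. (\<integral>\<^sup>+x. ennreal ((coth (x / y) - 1) * f x * g y) \<partial>Rpos) \<partial>Rpos)
        < ennreal (K_const \<sigma>) * wnorm p (phi p \<sigma>) f * wnorm q (psi q \<sigma>) g)
      \<and> (p < 1 \<longrightarrow> ennreal (K_const \<sigma>) * wnorm p (phi p \<sigma>) f * wnorm q (psi q \<sigma>) g
        < (\<integral>\<^sup>+y. (\<integral>\<^sup>+x. ennreal ((coth (x / y) - 1) * f x * g y) \<partial>Rpos) \<partial>Rpos))"
    if f: "f \<in> adm p (phi p \<sigma>)" and g: "g \<in> adm q (psi q \<sigma>)" for f g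
  proof -
    note fD = admD[OF f] and gD = admD[OF g]
    have n: "0 < haar_norm p (?F f)" "haar_norm p (?F f) < \<infinity>" "0 < haar_norm q (?G g)" "haar_norm q (?G g) < \<infinity>"
      using fD(3,4) gD(3,4) wnorm_phi[OF fD(1,2), of p \<sigma>] wnorm_psi[OF gD(1,2), of q \<sigma>] by simp_all
    show ?thesis
      using kern_conv_bilinear[OF assms(1) weighted_measurable[OF fD(1)] weighted_measurable[OF gD(1)] assms(2-4) n]
      unfolding wnorm_phi[OF fD(1,2)] wnorm_psi[OF gD(1,2)] kern_double_integral(2)[OF fD(1,2) gD(1,2), of \<sigma>]
      by blast
  qed
  show "p > 1 \<Longrightarrow> ineq_A (<) p q \<sigma> (K_const \<sigma>)" "p < 1 \<Longrightarrow> ineq_A (>) p q \<sigma> (K_const \<sigma>)"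
    unfolding ineq_A_def using * by blast+
qed

lemma ineq_B_K_const:
  assumes "\<sigma> > 1" "p \<noteq> 0" "p \<noteq> 1"
  shows "p > 1 \<Longrightarrow> ineq_B (<) p \<sigma> (K_const \<sigma>)"
    and "p < 1 \<Longrightarrow> ineq_B (>) p \<sigma> (K_const \<sigma>)"
proof -
  let ?F = "weighted (1 - \<sigma>)"
  let ?L = "\<lambda>f. epow (\<integral>\<^sup>+y. ennreal (y powr (- p * \<sigma> - 1)) *
            epow (\<integral>\<^sup>+x. ennreal ((coth (x / y) - 1) * f x) \<partial>Rpos) p \<partial>Rpos) (1 / p)"
  have *: "(p > 1 \<longrightarrow> ?L f < ennreal (K_const \<sigma>) * wnorm p (phi p \<sigma>) f)
      \<and> (p < 1 \<longrightarrow> ennreal (K_const \<sigma>) * wnorm p (phi p \<sigma>) f < ?L f)"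
    if f: "f \<in> adm p (phi p \<sigma>)" for f
  proof -
    note fD = admD[OF f]
    have n: "0 < haar_norm p (?F f)" "haar_norm p (?F f) < \<infinity>"
      using fD(3,4) wnorm_phi[OF fD(1,2), of p \<sigma>] by simp_all
    show ?thesis
      using kern_conv_norm[OF assms(1) weighted_measurable[OF fD(1)] assms(2,3) n]
      unfolding wnorm_phi[OF fD(1,2)] kern_integral_norm[OF fD(1,2)] by blast
  qed
  show "p > 1 \<Longrightarrow> ineq_B (<) p \<sigma> (K_const \<sigma>)" "p < 1 \<Longrightarrow> ineq_B (>) p \<sigma> (K_const \<sigma>)"
    unfolding ineq_B_def using * by blast+
qed

section \<open>Sharpness of the reverse inequalities\<close>

lemma nn_integral_haar_exp_abs_ln:
  assumes "0 < \<epsilon>"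
  shows "(\<integral>\<^sup>+x. ennreal (exp (- \<epsilon> * \<bar>ln x\<bar>)) \<partial>haar) = ennreal (2 / \<epsilon>)"
proof -
  let ?h = "\<lambda>s. ennreal (exp (- \<epsilon> * s)) * indicator {0..} s"
  have half: "(\<integral>\<^sup>+s. ?h s \<partial>lborel) = ennreal (1 / \<epsilon>)"
  proof -
    have lim: "((\<lambda>s. - exp (- \<epsilon> * s) / \<epsilon>) \<longlongrightarrow> - 0 / \<epsilon>) at_top"
    proof -
      have "filterlim (\<lambda>s. - \<epsilon> * s) at_bot at_top"
        using assms by (intro filterlim_tendsto_neg_mult_at_bot[OF tendsto_const _ filterlim_ident]) simp
      from filterlim_compose[OF exp_at_bot this] assms show ?thesis by (intro tendsto_intros) simp_all
    qed
    have "(\<integral>\<^sup>+s. ?h s \<partial>lborel) = ennreal (- 0 / \<epsilon> - (- exp (- \<epsilon> * 0) / \<epsilon>))"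
      using assms by (intro nn_integral_FTC_atLeast lim) (auto intro!: derivative_eq_intros)
    then show ?thesis by simp
  qed
  have "(\<integral>\<^sup>+x. ennreal (exp (- \<epsilon> * \<bar>ln x\<bar>)) \<partial>haar) = (\<integral>\<^sup>+s. ennreal (exp (- \<epsilon> * \<bar>s\<bar>)) \<partial>lborel)"
    by (subst nn_integral_haar_exp) simp_all
  also have "\<dots> = (\<integral>\<^sup>+s. ?h s + ?h (0 + - 1 * s) \<partial>lborel)"
  proof (rule nn_integral_cong_AE, rule AE_mp[OF AE_lborel_singleton[of 0]], intro AE_I2 impI)
    fix s :: real assume "s \<noteq> 0"
    then show "ennreal (exp (- \<epsilon> * \<bar>s\<bar>)) = ?h s + ?h (0 + - 1 * s)"
      by (cases "s > 0") auto
  qed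
  also have "\<dots> = (\<integral>\<^sup>+s. ?h s \<partial>lborel) + (\<integral>\<^sup>+s. ?h (0 + - 1 * s) \<partial>lborel)"
    by (intro nn_integral_add) auto
  also have "(\<integral>\<^sup>+s. ?h (0 + - 1 * s) \<partial>lborel) = (\<integral>\<^sup>+s. ?h s \<partial>lborel)"
    by (subst (2) nn_integral_real_affine[where c = "- 1" and t = 0]) simp_all
  finally show ?thesis using assms half by (simp flip: ennreal_plus)
qed

text \<open>The test function \<open>exp (- r \<bar>ln x\<bar>)\<close>; its powers are of the same form.\<close>

definition exp_ln :: "real \<Rightarrow> real \<Rightarrow> ennreal" where
  "exp_ln r x = ennreal (exp (- r * \<bar>ln x\<bar>))"

lemma exp_ln_measurable [measurable]: "exp_ln r \<in> borel_measurable borel"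
  unfolding exp_ln_def by measurable

lemma epow_exp_ln: "epow (exp_ln r x) p = exp_ln (r * p) x"
  unfolding exp_ln_def by (subst epow_ennreal) (auto simp: powr_def)

lemma haar_norm_exp_ln:
  assumes "0 < \<epsilon>" "p \<noteq> 0"
  shows "haar_norm p (exp_ln (\<epsilon> / p)) = ennreal ((2 / \<epsilon>) powr (1 / p))"
proof -
  have "(\<integral>\<^sup>+x. epow (exp_ln (\<epsilon> / p) x) p \<partial>haar) = ennreal (2 / \<epsilon>)"
    unfolding epow_exp_ln using nn_integral_haar_exp_abs_ln[OF assms(1)] assms(2)
    by (simp add: exp_ln_def)
  then show ?thesis using assms by (simp add: haar_norm_def epow_ennreal)
qed

text \<open>Since \<open>\<bar>\<bar>ln x\<bar> - \<bar>ln y\<bar>\<bar> \<le> \<bar>ln (x / y)\<bar>\<close>, the test functions are almost eigenfunctions of the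
  convolution.\<close>

lemma kern_conv_exp_ln_le:
  assumes "0 < y" "\<bar>r\<bar> \<le> \<delta>" "(\<integral>\<^sup>+u. kern \<sigma> u * ennreal (exp (\<delta> * \<bar>ln u\<bar>)) \<partial>haar) \<le> c"
  shows "kern_conv \<sigma> (exp_ln r) y \<le> c * exp_ln r y"
proof -
  let ?k = "\<lambda>u. kern \<sigma> u * ennreal (exp (\<delta> * \<bar>ln u\<bar>))"
  have "kern_conv \<sigma> (exp_ln r) y \<le> (\<integral>\<^sup>+x. ?k (x / y) * exp_ln r y \<partial>haar)"
    unfolding kern_conv_def
  proof (rule nn_integral_mono)
    fix x assume "x \<in> space haar"
    then have x: "0 < x" by simp
    have "- r * \<bar>ln x\<bar> + r * \<bar>ln y\<bar> \<le> \<bar>r\<bar> * \<bar>ln x - ln y\<bar>"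
    proof -
      have "- r * \<bar>ln x\<bar> + r * \<bar>ln y\<bar> = r * (\<bar>ln y\<bar> - \<bar>ln x\<bar>)" by (simp add: algebra_simps)
      also have "\<dots> \<le> \<bar>r\<bar> * \<bar>\<bar>ln y\<bar> - \<bar>ln x\<bar>\<bar>" by (simp flip: abs_mult)
      also have "\<dots> \<le> \<bar>r\<bar> * \<bar>ln x - ln y\<bar>" by (intro mult_left_mono) auto
      finally show ?thesis .
    qed
    also have "\<dots> \<le> \<delta> * \<bar>ln x - ln y\<bar>" using assms by (intro mult_right_mono) auto
    also have "ln x - ln y = ln (x / y)" using x assms by (simp add: ln_div)
    finally have "exp (- r * \<bar>ln x\<bar>) \<le> exp (\<delta> * \<bar>ln (x / y)\<bar> + - r * \<bar>ln y\<bar>)" by simp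
    then have "exp_ln r x \<le> ennreal (exp (\<delta> * \<bar>ln (x / y)\<bar>)) * exp_ln r y"
      unfolding exp_ln_def exp_add by (simp add: ennreal_leI flip: ennreal_mult)
    then show "kern \<sigma> (x / y) * exp_ln r x \<le> ?k (x / y) * exp_ln r y"
      unfolding mult.assoc by (intro mult_left_mono) auto
  qed
  also have "\<dots> = (\<integral>\<^sup>+x. ?k (x / y) \<partial>haar) * exp_ln r y"
    by (intro nn_integral_multc borel_measurable_haar) measurable
  also have "(\<integral>\<^sup>+x. ?k (x / y) \<partial>haar) = (\<integral>\<^sup>+u. ?k u \<partial>haar)"
    using assms(1) by (intro nn_integral_haar_scale) measurable
  finally show ?thesis using mult_right_mono[OF assms(3), of "exp_ln r y"] by (rule order_trans) simp
qed

text \<open>The real function that \<^const>\<open>weighted\<close> maps to \<open>F\<close>, for finite-valued \<open>F\<close>.\<close>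

definition unweighted :: "real \<Rightarrow> (real \<Rightarrow> ennreal) \<Rightarrow> real \<Rightarrow> real" where
  "unweighted a F x = x powr (- a) * enn2real (F x)"

lemma unweighted_borel:
  assumes [measurable]: "F \<in> borel_measurable borel"
  shows "unweighted a F \<in> borel_measurable Rpos"
  unfolding unweighted_def[abs_def] by (rule borel_measurable_Rpos) measurable

lemma unweighted_nonneg: "\<forall>x>0. 0 \<le> unweighted a F x"
  by (simp add: unweighted_def)

lemma weighted_unweighted:
  assumes "F x < top" "0 < x"
  shows "weighted a (unweighted a F) x = F x"
proof -
  have "x powr a * (x powr (- a) * enn2real (F x)) = enn2real (F x)"
    using assms by (simp add: powr_minus)
  then show ?thesis unfolding weighted_def unweighted_def using assms by (simp only: ennreal_enn2real)
qed

lemma haar_norm_cong: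
  assumes "\<And>x. 0 < x \<Longrightarrow> F x = G x" shows "haar_norm p F = haar_norm p G"
  unfolding haar_norm_def
  by (intro arg_cong2[where f = epow] nn_integral_cong refl) (simp add: assms)

lemma kern_conv_cong:
  assumes "\<And>x. 0 < x \<Longrightarrow> F x = G x" shows "kern_conv \<sigma> F = kern_conv \<sigma> G"
  unfolding kern_conv_def[abs_def]
  by (intro ext nn_integral_cong) (simp add: assms)

lemma unweighted_adm_phi:
  assumes F: "F \<in> borel_measurable borel" "\<And>x. 0 < x \<Longrightarrow> F x < top"
    and n: "0 < haar_norm p F" "haar_norm p F < \<infinity>"
  shows "unweighted (1 - \<sigma>) F \<in> adm p (phi p \<sigma>)"
    and "wnorm p (phi p \<sigma>) (unweighted (1 - \<sigma>) F) = haar_norm p F"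
proof -
  have "haar_norm p (weighted (1 - \<sigma>) (unweighted (1 - \<sigma>) F)) = haar_norm p F"
    by (intro haar_norm_cong weighted_unweighted F)
  then show *: "wnorm p (phi p \<sigma>) (unweighted (1 - \<sigma>) F) = haar_norm p F"
    by (simp add: wnorm_phi[OF unweighted_borel[OF F(1)] unweighted_nonneg])
  show "unweighted (1 - \<sigma>) F \<in> adm p (phi p \<sigma>)"
    using n * unweighted_borel[OF F(1)] by (auto simp: adm_def unweighted_nonneg)
qed

lemma unweighted_adm_psi:
  assumes F: "F \<in> borel_measurable borel" "\<And>x. 0 < x \<Longrightarrow> F x < top"
    and n: "0 < haar_norm q F" "haar_norm q F < \<infinity>"
  shows "unweighted (1 + \<sigma>) F \<in> adm q (psi q \<sigma>)"
    and "wnorm q (psi q \<sigma>) (unweighted (1 + \<sigma>) F) = haar_norm q F"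
proof -
  have "haar_norm q (weighted (1 + \<sigma>) (unweighted (1 + \<sigma>) F)) = haar_norm q F"
    by (intro haar_norm_cong weighted_unweighted F)
  then show *: "wnorm q (psi q \<sigma>) (unweighted (1 + \<sigma>) F) = haar_norm q F"
    by (simp add: wnorm_psi[OF unweighted_borel[OF F(1)] unweighted_nonneg])
  show "unweighted (1 + \<sigma>) F \<in> adm q (psi q \<sigma>)"
    using n * unweighted_borel[OF F(1)] by (auto simp: adm_def unweighted_nonneg)
qed

lemma kern_double_integral_unweighted:
  assumes F: "F \<in> borel_measurable borel" "\<And>x. 0 < x \<Longrightarrow> F x < top"
    and G: "G \<in> borel_measurable borel" "\<And>x. 0 < x \<Longrightarrow> G x < top"
  shows "(\<integral>\<^sup>+y. (\<integral>\<^sup>+x. ennreal ((coth (x / y) - 1) * unweighted (1 - \<sigma>) F x * unweighted (1 + \<sigma>) G y) \<partial>Rpos) \<partial>Rpos)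
    = (\<integral>\<^sup>+y. kern_conv \<sigma> F y * G y \<partial>haar)"
proof -
  have eq: "kern_conv \<sigma> (weighted (1 - \<sigma>) (unweighted (1 - \<sigma>) F)) = kern_conv \<sigma> F"
    by (intro kern_conv_cong weighted_unweighted F)
  show ?thesis
    unfolding kern_double_integral(2)[where f = "unweighted (1 - \<sigma>) F" and g = "unweighted (1 + \<sigma>) G"
        and \<sigma> = \<sigma>, OF unweighted_borel[OF F(1)] unweighted_nonneg unweighted_borel[OF G(1)] unweighted_nonneg] eq
    by (rule nn_integral_cong) (simp add: weighted_unweighted G(2))
qed

lemma kern_integral_norm_unweighted:
  assumes F: "F \<in> borel_measurable borel" "\<And>x. 0 < x \<Longrightarrow> F x < top"
  shows "epow (\<integral>\<^sup>+y. ennreal (y powr (- p * \<sigma> - 1)) *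
            epow (\<integral>\<^sup>+x. ennreal ((coth (x / y) - 1) * unweighted (1 - \<sigma>) F x) \<partial>Rpos) p \<partial>Rpos) (1 / p)
      = haar_norm p (kern_conv \<sigma> F)"
proof -
  have "kern_conv \<sigma> (weighted (1 - \<sigma>) (unweighted (1 - \<sigma>) F)) = kern_conv \<sigma> F"
    by (intro kern_conv_cong weighted_unweighted F)
  then show ?thesis
    unfolding kern_integral_norm[OF unweighted_borel[OF F(1)] unweighted_nonneg] by simp
qed

lemma not_ineq_A_gt:
  assumes s: "\<sigma> > 1" and p: "p \<noteq> 0" "p \<noteq> 1" "1 / p + 1 / q = 1" and k: "K_const \<sigma> < k"
  shows "\<not> ineq_A (>) p q \<sigma> k"
proof
  assume A: "ineq_A (>) p q \<sigma> k"
  have q: "q \<noteq> 0" using p by auto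
  obtain \<delta> where \<delta>: "0 < \<delta>" and less: "(\<integral>\<^sup>+u. kern \<sigma> u * ennreal (exp (\<delta> * \<bar>ln u\<bar>)) \<partial>haar) < ennreal k"
    using kern_exp_integral_close[OF s k] by blast
  define \<epsilon> where "\<epsilon> = \<delta> * \<bar>p\<bar>"
  have \<epsilon>: "0 < \<epsilon>" and r: "\<bar>\<epsilon> / p\<bar> \<le> \<delta>" using \<delta> p by (auto simp: \<epsilon>_def abs_mult)
  let ?F = "exp_ln (\<epsilon> / p)" and ?G = "exp_ln (\<epsilon> / q)"
  have F: "?F \<in> borel_measurable borel" "\<And>x. ?F x < top"
    and G: "?G \<in> borel_measurable borel" "\<And>x. ?G x < top" by (auto simp: exp_ln_def)
  have n: "0 < haar_norm p ?F" "haar_norm p ?F < \<infinity>" "0 < haar_norm q ?G" "haar_norm q ?G < \<infinity>"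
    using \<epsilon> p q by (simp_all add: haar_norm_exp_ln)
  have FG: "?F y * ?G y = exp_ln \<epsilon> y" for y
  proof -
    have "\<epsilon> / p + \<epsilon> / q = \<epsilon> * (1 / p + 1 / q)" by (simp add: distrib_left)
    then have "\<epsilon> / p + \<epsilon> / q = \<epsilon>" using p by simp
    moreover have "- (\<epsilon> / p) * \<bar>ln y\<bar> + - (\<epsilon> / q) * \<bar>ln y\<bar> = - (\<epsilon> / p + \<epsilon> / q) * \<bar>ln y\<bar>"
      by (simp add: algebra_simps)
    ultimately have "- (\<epsilon> / p) * \<bar>ln y\<bar> + - (\<epsilon> / q) * \<bar>ln y\<bar> = - \<epsilon> * \<bar>ln y\<bar>" by (simp only:)
    then show ?thesis
      unfolding exp_ln_def by (simp only: ennreal_mult[symmetric] exp_ge_zero exp_add[symmetric])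
  qed
  have "(\<integral>\<^sup>+y. kern_conv \<sigma> ?F y * ?G y \<partial>haar) \<le> (\<integral>\<^sup>+y. ennreal k * exp_ln \<epsilon> y \<partial>haar)"
  proof (rule nn_integral_mono)
    fix y assume "y \<in> space haar"
    then have "kern_conv \<sigma> ?F y \<le> ennreal k * ?F y"
      using r less by (intro kern_conv_exp_ln_le[where \<delta> = \<delta>]) auto
    then have "kern_conv \<sigma> ?F y * ?G y \<le> ennreal k * ?F y * ?G y" by (rule mult_right_mono) simp
    then show "kern_conv \<sigma> ?F y * ?G y \<le> ennreal k * exp_ln \<epsilon> y" by (simp only: mult.assoc FG)
  qed
  also have "\<dots> = ennreal k * ennreal (2 / \<epsilon>)"
    using nn_integral_haar_exp_abs_ln[OF \<epsilon>]
    by (simp add: nn_integral_cmult borel_measurable_haar exp_ln_def[abs_def])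
  also have "ennreal (2 / \<epsilon>) = haar_norm p ?F * haar_norm q ?G"
  proof -
    have "(2 / \<epsilon>) powr (1 / p) * (2 / \<epsilon>) powr (1 / q) = (2 / \<epsilon>) powr (1 / p + 1 / q)"
      by (simp only: powr_add)
    also have "\<dots> = 2 / \<epsilon>" using \<epsilon> by (simp only: p) simp
    finally show ?thesis using \<epsilon> p q by (simp add: haar_norm_exp_ln flip: ennreal_mult)
  qed
  finally have "(\<integral>\<^sup>+y. kern_conv \<sigma> ?F y * ?G y \<partial>haar) \<le> ennreal k * haar_norm p ?F * haar_norm q ?G"
    by (simp only: mult.assoc)
  moreover have "ennreal k * haar_norm p ?F * haar_norm q ?G < (\<integral>\<^sup>+y. kern_conv \<sigma> ?F y * ?G y \<partial>haar)"
    using A unweighted_adm_phi[OF F n(1,2), of \<sigma>] unweighted_adm_psi[OF G n(3,4), of \<sigma>]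
      kern_double_integral_unweighted[OF F G, of \<sigma>]
    unfolding ineq_A_def by fastforce
  ultimately show False by simp
qed

lemma not_ineq_B_gt:
  assumes s: "\<sigma> > 1" and p: "p \<noteq> 0" and k: "K_const \<sigma> < k"
  shows "\<not> ineq_B (>) p \<sigma> k"
proof
  assume B: "ineq_B (>) p \<sigma> k"
  obtain \<delta> where \<delta>: "0 < \<delta>" and less: "(\<integral>\<^sup>+u. kern \<sigma> u * ennreal (exp (\<delta> * \<bar>ln u\<bar>)) \<partial>haar) < ennreal k"
    using kern_exp_integral_close[OF s k] by blast
  have k0: "0 < k" using k K_const_pos[OF s] by simp
  define \<epsilon> where "\<epsilon> = \<delta> * \<bar>p\<bar>"
  have \<epsilon>: "0 < \<epsilon>" and r: "\<bar>\<epsilon> / p\<bar> \<le> \<delta>" using \<delta> p by (auto simp: \<epsilon>_def abs_mult)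
  let ?F = "exp_ln (\<epsilon> / p)"
  have F: "?F \<in> borel_measurable borel" "\<And>x. ?F x < top" by (auto simp: exp_ln_def)
  have n: "0 < haar_norm p ?F" "haar_norm p ?F < \<infinity>"
    using \<epsilon> p by (simp_all add: haar_norm_exp_ln)
  have "haar_norm p (kern_conv \<sigma> ?F) \<le> haar_norm p (\<lambda>y. ennreal k * ?F y)"
  proof (intro haar_norm_mono p)
    fix y :: real assume "0 < y"
    then show "kern_conv \<sigma> ?F y \<le> ennreal k * ?F y"
      using r less by (intro kern_conv_exp_ln_le[where \<delta> = \<delta>]) auto
  qed
  also have "\<dots> = ennreal k * haar_norm p ?F"
    using k0 p by (intro haar_norm_cmult borel_measurable_haar F)
  also have "\<dots> < haar_norm p (kern_conv \<sigma> ?F)"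
    using B unweighted_adm_phi[OF F n, of \<sigma>] kern_integral_norm_unweighted[OF F, of p \<sigma>]
    unfolding ineq_B_def by fastforce
  finally show False by simp
qed

lemma l1norm_finite:
  assumes "\<And>x. 0 < x \<Longrightarrow> x \<le> b \<Longrightarrow> f x \<le> c" "\<And>x. b < x \<Longrightarrow> f x = 0"
  shows "l1norm f < \<infinity>"
proof -
  have "l1norm f \<le> (\<integral>\<^sup>+x. ennreal c * indicator {0..b} x \<partial>Rpos)"
    unfolding l1norm_def using assms
    by (intro nn_integral_mono) (auto split: split_indicator simp: not_le intro: ennreal_leI)
  also have "\<dots> = (\<integral>\<^sup>+x. ennreal c * indicator {0..b} x * indicator {0<..} x \<partial>lborel)"
    by (intro nn_integral_Rpos_borel) measurable
  also have "\<dots> \<le> (\<integral>\<^sup>+x. ennreal c * indicator {0..b} x \<partial>lborel)"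
    by (intro nn_integral_mono) (auto split: split_indicator)
  also have "\<dots> = ennreal c * emeasure lborel {0..b}"
    by (intro nn_integral_cmult_indicator) simp
  also have "\<dots> < \<infinity>" by (cases "0 \<le> b") (simp_all add: ennreal_mult_less_top)
  finally show ?thesis .
qed

lemma l1norm_pos:
  assumes f: "f \<in> adm r w" and r: "r > 0"
  shows "0 < l1norm f"
proof (rule ccontr)
  note [measurable] = admD(1)[OF f]
  assume "\<not> 0 < l1norm f"
  then have "AE x in Rpos. ennreal (f x) = 0"
    unfolding l1norm_def by (simp add: nn_integral_0_iff_AE)
  then have "(\<integral>\<^sup>+x. ennreal (w x) * epow (ennreal (f x)) r \<partial>Rpos) = (\<integral>\<^sup>+x. 0 \<partial>Rpos)"
    using r by (intro nn_integral_cong_AE) (auto elim: eventually_mono)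
  then have "wnorm r w f = 0" using r by (simp add: wnorm_def)
  with admD(3)[OF f] show False by simp
qed

lemma adm1I:
  assumes "f \<in> adm r w" "r > 0" "l1norm f < \<infinity>" shows "f \<in> adm1 r w"
  using assms l1norm_pos[OF assms(1,2)] by (auto simp: adm1_def)

text \<open>The test function is cut off at \<open>exp n\<close> to make \<open>f\<close> integrable. A constant \<open>k'\<close> strictly between
  \<^const>\<open>K_const\<close> and \<open>k\<close> leaves room for the loss of norm.\<close>

lemma not_ineq_D_gt:
  assumes s: "\<sigma> > 1" and p: "0 < p" "p < 1" and k: "K_const \<sigma> < k"
  shows "\<not> ineq_D (>) p \<sigma> k"
proof
  assume D: "ineq_D (>) p \<sigma> k"
  define k' where "k' = (K_const \<sigma> + k) / 2"
  have k': "K_const \<sigma> < k'" "k' < k" "0 < k'" "0 < k" using k K_const_pos[OF s] by (auto simp: k'_def)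
  obtain \<delta> where \<delta>: "0 < \<delta>" and less: "(\<integral>\<^sup>+u. kern \<sigma> u * ennreal (exp (\<delta> * \<bar>ln u\<bar>)) \<partial>haar) < ennreal k'"
    using kern_exp_integral_close[OF s k'(1)] by blast
  define \<epsilon> where "\<epsilon> = \<delta> * p"
  have \<epsilon>: "0 < \<epsilon>" and r: "\<bar>\<epsilon> / p\<bar> \<le> \<delta>" using \<delta> p by (auto simp: \<epsilon>_def)
  let ?E = "exp_ln (\<epsilon> / p)"
  define F where "F = (\<lambda>n::nat. \<lambda>x. ?E x * indicator {..exp (real n)} x)"
  have F: "F n \<in> borel_measurable borel" "F n x < top" for n x
    by (auto simp: F_def exp_ln_def[abs_def] split: split_indicator)
  have Fle: "F n x \<le> ?E x" for n x by (simp add: F_def split: split_indicator)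
  have Fp: "epow (F n x) p = exp_ln \<epsilon> x * indicator {..exp (real n)} x" for n x
    using p by (simp add: F_def epow_exp_ln split: split_indicator)
  have "(k' / k) powr p * (2 / \<epsilon>) < 1 * (2 / \<epsilon>)"
    using k' p \<epsilon> powr_less_mono2[of p "k' / k" 1] by (intro mult_strict_right_mono) auto
  then have "ennreal ((k' / k) powr p * (2 / \<epsilon>)) < ennreal (2 / \<epsilon>)"
    using \<epsilon> by (intro ennreal_lessI) auto
  also have "\<dots> = (\<integral>\<^sup>+x. (SUP n::nat. exp_ln \<epsilon> x * indicator {..exp (real n)} x) \<partial>haar)"
  proof -
    have "(SUP n::nat. exp_ln \<epsilon> x * indicator {..exp (real n)} x) = exp_ln \<epsilon> x" if "0 < x" for x
    proof -
      obtain n :: nat where "ln x \<le> real n" using real_arch_simple by blast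
      then have n: "x \<le> exp (real n)" using that exp_le_cancel_iff[of "ln x" "real n"] by simp
      show ?thesis
        by (intro antisym SUP_least SUP_upper2[of n]) (use n in \<open>auto split: split_indicator\<close>)
    qed
    then have "(\<integral>\<^sup>+x. (SUP n::nat. exp_ln \<epsilon> x * indicator {..exp (real n)} x) \<partial>haar)
        = (\<integral>\<^sup>+x. exp_ln \<epsilon> x \<partial>haar)"
      by (intro nn_integral_cong) simp
    then show ?thesis using nn_integral_haar_exp_abs_ln[OF \<epsilon>] by (simp add: exp_ln_def)
  qed
  also have "\<dots> = (SUP n::nat. \<integral>\<^sup>+x. exp_ln \<epsilon> x * indicator {..exp (real n)} x \<partial>haar)"
  proof (intro nn_integral_monotone_convergence_SUP borel_measurable_haar)
    show "incseq (\<lambda>(n::nat) x. exp_ln \<epsilon> x * indicator {..exp (real n)} x)"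
      by (auto simp: incseq_def le_fun_def subset_eq intro!: mult_left_mono indicator_leI
          elim: order_trans)
  qed measurable
  finally obtain n where n: "ennreal ((k' / k) powr p * (2 / \<epsilon>)) < (\<integral>\<^sup>+x. epow (F n x) p \<partial>haar)"
    unfolding Fp less_SUP_iff by blast
  have "epow (ennreal ((k' / k) powr p * (2 / \<epsilon>))) (1 / p) < haar_norm p (F n)"
    unfolding haar_norm_def using p by (intro epow_strict_mono n) simp
  moreover have "epow (ennreal ((k' / k) powr p * (2 / \<epsilon>))) (1 / p)
      = ennreal (((k' / k) powr p * (2 / \<epsilon>)) powr (1 / p))"
    using k' \<epsilon> by (intro epow_ennreal) simp
  moreover have "((k' / k) powr p * (2 / \<epsilon>)) powr (1 / p) = k' / k * (2 / \<epsilon>) powr (1 / p)"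
    using k' \<epsilon> p by (subst powr_mult) (auto simp: powr_powr)
  ultimately have low: "ennreal (k' / k * (2 / \<epsilon>) powr (1 / p)) < haar_norm p (F n)"
    by (simp only:)
  have up: "haar_norm p (F n) \<le> haar_norm p ?E"
    using p by (intro haar_norm_mono Fle) simp
  have nF: "0 < haar_norm p (F n)" "haar_norm p (F n) < \<infinity>"
  proof -
    show "0 < haar_norm p (F n)" using low by (rule le_less_trans[rotated]) simp
    show "haar_norm p (F n) < \<infinity>"
      using up \<epsilon> p by (simp add: haar_norm_exp_ln le_less_trans)
  qed
  let ?f = "unweighted (1 - \<sigma>) (F n)"
  note adm = unweighted_adm_phi[OF F nF, of \<sigma>]
  have "l1norm ?f < \<infinity>"
  proof (rule l1norm_finite)
    fix x :: real assume x: "0 < x" "x \<le> exp (real n)"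
    have "?f x = x powr (\<sigma> - 1) * exp (- (\<epsilon> / p) * \<bar>ln x\<bar>)"
      using x by (simp add: unweighted_def F_def exp_ln_def)
    also have "\<dots> \<le> exp (real n) powr (\<sigma> - 1) * 1"
      using x s p \<epsilon> by (intro mult_mono powr_mono2) auto
    finally show "?f x \<le> exp (real n) powr (\<sigma> - 1)" by simp
  qed (simp add: unweighted_def F_def)
  then have f1: "?f \<in> adm1 p (phi p \<sigma>)" using adm(1) p by (intro adm1I) auto
  have "ennreal k * haar_norm p (F n) < haar_norm p (kern_conv \<sigma> (F n))"
    using D[unfolded ineq_D_def, rule_format, OF f1]
    unfolding ineq_D_integral_eq[OF f1] kern_integral_norm_unweighted[OF F] adm(2) .
  also have "\<dots> \<le> haar_norm p (\<lambda>y. ennreal k' * ?E y)"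
  proof (rule haar_norm_mono)
    fix y :: real assume y: "0 < y"
    have "kern_conv \<sigma> (F n) y \<le> kern_conv \<sigma> ?E y"
      unfolding kern_conv_def by (intro nn_integral_mono mult_left_mono Fle) simp
    also have "\<dots> \<le> ennreal k' * ?E y"
      using y r less by (intro kern_conv_exp_ln_le[where \<delta> = \<delta>]) auto
    finally show "kern_conv \<sigma> (F n) y \<le> ennreal k' * ?E y" .
  qed (use p in simp)
  also have "\<dots> = ennreal k' * haar_norm p ?E"
    using k' p by (intro haar_norm_cmult borel_measurable_haar) auto
  also have "\<dots> = ennreal (k * (k' / k * (2 / \<epsilon>) powr (1 / p)))"
    using \<epsilon> p k' by (simp add: haar_norm_exp_ln flip: ennreal_mult)
  also have "\<dots> = ennreal k * ennreal (k' / k * (2 / \<epsilon>) powr (1 / p))"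
    using k' by (intro ennreal_mult) auto
  also have "\<dots> \<le> ennreal k * haar_norm p (F n)"
    using low by (intro mult_left_mono) auto
  finally show False by simp
qed

section \<open>Sharpness of the direct inequalities\<close>

text \<open>The indicator of \<open>[exp (- n), exp n]\<close>, which has Haar measure \<open>2 n\<close>.\<close>

definition exp_box :: "nat \<Rightarrow> real \<Rightarrow> ennreal" where
  "exp_box n x = indicator {exp (- real n)..exp (real n)} x"

lemma exp_box_measurable [measurable]: "exp_box n \<in> borel_measurable borel"
  unfolding exp_box_def by measurable

lemma exp_box_finite: "exp_box n x < top"
  by (simp add: exp_box_def split: split_indicator)

lemma nn_integral_exp_box: "(\<integral>\<^sup>+x. exp_box n x \<partial>haar) = ennreal (2 * real n)"
  using nn_integral_haar_Icc[of "exp (- real n)" "exp (real n)"] by (simp add: exp_box_def)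

lemma haar_norm_exp_box:
  assumes "p > 0" "n > 0" shows "haar_norm p (exp_box n) = ennreal ((2 * real n) powr (1 / p))"
proof -
  have "epow (exp_box n x) p = exp_box n x" for x
    using assms(1) by (simp add: exp_box_def epow_def split: split_indicator)
  then show ?thesis using assms by (simp add: haar_norm_def nn_integral_exp_box epow_ennreal)
qed

text \<open>If \<open>x / y\<close> lies in the box of size \<open>m\<close> and \<open>y\<close> in that of size \<open>j\<close>, then \<open>x\<close> lies in that of size
  \<open>m + j\<close>. So on the smaller box the convolution is at least the kernel integral over the box of
  size \<open>m\<close>.\<close>

lemma kern_conv_exp_box_ge:
  assumes "0 < y"
  shows "(\<integral>\<^sup>+u. kern \<sigma> u * exp_box m u \<partial>haar) * exp_box j y \<le> kern_conv \<sigma> (exp_box (m + j)) y"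
proof -
  have "(\<integral>\<^sup>+u. kern \<sigma> u * exp_box m u \<partial>haar) * exp_box j y
      = (\<integral>\<^sup>+x. kern \<sigma> (x / y) * exp_box m (x / y) \<partial>haar) * exp_box j y"
    using assms by (subst nn_integral_haar_scale[where u = "\<lambda>u. kern \<sigma> u * exp_box m u"]) simp_all
  also have "\<dots> = (\<integral>\<^sup>+x. kern \<sigma> (x / y) * exp_box m (x / y) * exp_box j y \<partial>haar)"
    by (intro nn_integral_multc[symmetric] borel_measurable_haar) measurable
  also have "\<dots> \<le> kern_conv \<sigma> (exp_box (m + j)) y"
    unfolding kern_conv_def mult.assoc
  proof (intro nn_integral_mono mult_left_mono)
    fix x :: real
    have "exp (- real (m + j)) \<le> x \<and> x \<le> exp (real (m + j))"
      if "exp (- real m) \<le> x / y" "x / y \<le> exp (real m)" "exp (- real j) \<le> y" "y \<le> exp (real j)"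
    proof -
      have "exp (- real m) * exp (- real j) \<le> (x / y) * y"
        using that assms by (intro mult_mono) (auto intro: order_trans[OF exp_ge_zero])
      moreover have "(x / y) * y \<le> exp (real m) * exp (real j)"
        using that assms by (intro mult_mono) auto
      ultimately show ?thesis using assms by (simp flip: exp_add)
    qed
    then show "exp_box m (x / y) * exp_box j y \<le> exp_box (m + j) x"
      by (auto simp: exp_box_def split: split_indicator)
  qed simp
  finally show ?thesis .
qed

lemma unweighted_exp_box_adm1:
  assumes "p > 0" "n > 0"
  shows "unweighted (1 - \<sigma>) (exp_box n) \<in> adm1 p (phi p \<sigma>)"
    and "unweighted (1 + \<sigma>) (exp_box n) \<in> adm1 p (psi p \<sigma>)"
proof -
  have n: "0 < haar_norm p (exp_box n)" "haar_norm p (exp_box n) < \<infinity>"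
    using assms by (simp_all add: haar_norm_exp_box)
  have l1: "l1norm (unweighted a (exp_box n)) < \<infinity>" for a
  proof (rule l1norm_finite)
    fix x :: real assume x: "0 < x" "x \<le> exp (real n)"
    show "unweighted a (exp_box n) x \<le> exp (\<bar>a\<bar> * real n)"
    proof (cases "exp (- real n) \<le> x")
      case True
      have "\<bar>ln x\<bar> \<le> real n"
        using x True exp_le_cancel_iff[of "ln x" "real n"] exp_le_cancel_iff[of "- real n" "ln x"] by auto
      then have "\<bar>a\<bar> * \<bar>ln x\<bar> \<le> \<bar>a\<bar> * real n" by (intro mult_left_mono) auto
      moreover have "- a * ln x \<le> \<bar>a\<bar> * \<bar>ln x\<bar>" by (simp flip: abs_mult)
      ultimately have "- a * ln x \<le> \<bar>a\<bar> * real n" by linarith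
      then have "x powr (- a) \<le> exp (\<bar>a\<bar> * real n)" using x by (simp add: powr_def)
      then show ?thesis using x True by (simp add: unweighted_def exp_box_def)
    qed (simp add: unweighted_def exp_box_def)
  qed (simp add: unweighted_def exp_box_def)
  show "unweighted (1 - \<sigma>) (exp_box n) \<in> adm1 p (phi p \<sigma>)"
    using assms l1 n by (intro adm1I unweighted_adm_phi exp_box_finite exp_box_measurable) auto
  show "unweighted (1 + \<sigma>) (exp_box n) \<in> adm1 p (psi p \<sigma>)"
    using assms l1 n by (intro adm1I unweighted_adm_psi exp_box_finite exp_box_measurable) auto
qed

lemma exists_large_nat:
  fixes c c' :: real
  assumes "c < c'" obtains j :: nat where "j > 0" "c * (2 * real (m + j)) \<le> c' * (2 * real j)"
proof -
  obtain j :: nat where j: "c * real m / (c' - c) < real j" using reals_Archimedean2 by blast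
  then have "c * real m / (c' - c) \<le> real (Suc j)" by simp
  then have "c * real m \<le> real (Suc j) * (c' - c)" using assms by (simp add: pos_divide_le_eq)
  then have "c * (2 * real (m + Suc j)) \<le> c' * (2 * real (Suc j))" by (simp add: algebra_simps)
  then show ?thesis using that[of "Suc j"] by blast
qed

lemma not_ineq_C_less:
  assumes s: "\<sigma> > 1" and p: "p > 1" and pq: "1 / p + 1 / q = 1" and k: "k < K_const \<sigma>"
  shows "\<not> ineq_C (<) p q \<sigma> k"
proof
  assume C: "ineq_C (<) p q \<sigma> k"
  have q: "q > 0"
  proof -
    have "1 / p < 1" using p by simp
    then have "0 < 1 / q" using pq by linarith
    then show ?thesis by simp
  qed
  \<comment> \<open>as a constant in \<^typ>\<open>ennreal\<close>, a negative \<open>k\<close> is \<open>0\<close>\<close>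
  define c where "c = max 0 k"
  have kc: "ennreal k = ennreal c" by (simp add: c_def max_def ennreal_neg)
  have c: "0 \<le> c" "c < K_const \<sigma>" using k K_const_pos[OF s] by (auto simp: c_def)
  then obtain c' where c': "c < c'" "c' < K_const \<sigma>" using dense by blast
  obtain m :: nat where m: "ennreal c' < (\<integral>\<^sup>+u. kern \<sigma> u * exp_box m u \<partial>haar)"
    using kern_Icc_integral_close[OF s c'(2)] unfolding exp_box_def by blast
  obtain j :: nat where j: "j > 0" "c * (2 * real (m + j)) \<le> c' * (2 * real j)"
    using exists_large_nat[OF c'(1)] by blast
  let ?F = "exp_box (m + j)"
  have mj: "m + j > 0" using j by simp
  have nF: "0 < haar_norm r ?F" "haar_norm r ?F < \<infinity>" if "r > 0" for r
    using that mj by (simp_all add: haar_norm_exp_box del: of_nat_add)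
  have p0: "p > 0" using p by simp
  note Fm = exp_box_measurable exp_box_finite
  have "(\<integral>\<^sup>+y. kern_conv \<sigma> ?F y * ?F y \<partial>haar) < ennreal c * haar_norm p ?F * haar_norm q ?F"
    using C[unfolded ineq_C_iff[OF disjI1[OF refl]], rule_format,
        OF unweighted_exp_box_adm1(1)[OF p0 mj] unweighted_exp_box_adm1(2)[OF q mj]]
    unfolding kern_double_integral_unweighted[OF Fm Fm] kc
      unweighted_adm_phi(2)[OF Fm nF[OF p0]] unweighted_adm_psi(2)[OF Fm nF[OF q]] .
  also have "\<dots> = ennreal (c * (2 * real (m + j)))"
  proof -
    have "(2 * real (m + j)) powr (1 / p) * (2 * real (m + j)) powr (1 / q) = (2 * real (m + j)) powr 1"
      by (simp only: powr_add[symmetric] pq)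
    then have "c * (2 * real (m + j)) powr (1 / p) * (2 * real (m + j)) powr (1 / q) = c * (2 * real (m + j))"
      using mj by (simp add: mult.assoc)
    moreover have "ennreal c * haar_norm p ?F * haar_norm q ?F
        = ennreal (c * (2 * real (m + j)) powr (1 / p) * (2 * real (m + j)) powr (1 / q))"
      using c by (simp only: haar_norm_exp_box[OF p0 mj] haar_norm_exp_box[OF q mj]
          ennreal_mult[symmetric] powr_ge_zero mult_nonneg_nonneg)
    ultimately show ?thesis by (simp only:)
  qed
  also have "\<dots> \<le> ennreal (c' * (2 * real j))" using j(2) by (rule ennreal_leI)
  also have "\<dots> = ennreal c' * (\<integral>\<^sup>+y. exp_box j y \<partial>haar)"
    using c c' by (simp only: nn_integral_exp_box) (intro ennreal_mult, auto)
  also have "\<dots> = (\<integral>\<^sup>+y. ennreal c' * exp_box j y \<partial>haar)"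
    by (intro nn_integral_cmult[symmetric] borel_measurable_haar) simp
  also have "\<dots> \<le> (\<integral>\<^sup>+y. kern_conv \<sigma> ?F y * ?F y \<partial>haar)"
  proof (rule nn_integral_mono)
    fix y assume "y \<in> space haar"
    then have y: "0 < y" by simp
    have "ennreal c' * exp_box j y \<le> (\<integral>\<^sup>+u. kern \<sigma> u * exp_box m u \<partial>haar) * exp_box j y"
      using m by (intro mult_right_mono) auto
    also have "\<dots> \<le> kern_conv \<sigma> ?F y" by (rule kern_conv_exp_box_ge[OF y])
    finally have "ennreal c' * exp_box j y * exp_box j y \<le> kern_conv \<sigma> ?F y * exp_box j y"
      by (rule mult_right_mono) simp
    moreover have "exp_box j y * exp_box j y = exp_box j y" by (simp add: exp_box_def split: split_indicator)
    moreover have "exp_box j y \<le> ?F y"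
    proof -
      have "{exp (- real j)..exp (real j)} \<subseteq> {exp (- real (m + j))..exp (real (m + j))}"
        by (intro atLeastatMost_subset_iff[THEN iffD2] disjI2 conjI) simp_all
      then show ?thesis unfolding exp_box_def by (intro indicator_leI) blast
    qed
    ultimately show "ennreal c' * exp_box j y \<le> kern_conv \<sigma> ?F y * ?F y"
      using mult_left_mono[of "exp_box j y" "?F y" "kern_conv \<sigma> ?F y"]
      by (simp only: mult.assoc) (rule order_trans, auto)
  qed
  finally show False by simp
qed

lemma not_ineq_D_less:
  assumes s: "\<sigma> > 1" and p: "p > 1" and k: "k < K_const \<sigma>"
  shows "\<not> ineq_D (<) p \<sigma> k"
proof
  assume D: "ineq_D (<) p \<sigma> k"
  \<comment> \<open>as a constant in \<^typ>\<open>ennreal\<close>, a negative \<open>k\<close> is \<open>0\<close>\<close>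
  define c where "c = max 0 k"
  have kc: "ennreal k = ennreal c" by (simp add: c_def max_def ennreal_neg)
  have c: "0 \<le> c" "c < K_const \<sigma>" using k K_const_pos[OF s] by (auto simp: c_def)
  then obtain c' where c': "c < c'" "c' < K_const \<sigma>" using dense by blast
  obtain m :: nat where m: "ennreal c' < (\<integral>\<^sup>+u. kern \<sigma> u * exp_box m u \<partial>haar)"
    using kern_Icc_integral_close[OF s c'(2)] unfolding exp_box_def by blast
  have p0: "p > 0" using p by simp
  have "c powr p < c' powr p" using c c' p by (intro powr_less_mono2) auto
  then obtain j :: nat where j: "j > 0" "c powr p * (2 * real (m + j)) \<le> c' powr p * (2 * real j)"
    using exists_large_nat by blast
  let ?F = "exp_box (m + j)"
  have mj: "m + j > 0" using j by simp
  have nF: "0 < haar_norm p ?F" "haar_norm p ?F < \<infinity>"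
    using p0 mj by (simp_all add: haar_norm_exp_box del: of_nat_add)
  note Fm = exp_box_measurable exp_box_finite
  note f1 = unweighted_exp_box_adm1(1)[OF p0 mj, of \<sigma>]
  have "haar_norm p (kern_conv \<sigma> ?F) < ennreal c * haar_norm p ?F"
    using D[unfolded ineq_D_def, rule_format, OF f1]
    unfolding ineq_D_integral_eq[OF f1] kern_integral_norm_unweighted[OF Fm] unweighted_adm_phi(2)[OF Fm nF] kc .
  also have "\<dots> = ennreal (c * (2 * real (m + j)) powr (1 / p))"
    using c by (simp only: haar_norm_exp_box[OF p0 mj] ennreal_mult[symmetric] powr_ge_zero)
  also have "\<dots> \<le> ennreal (c' * (2 * real j) powr (1 / p))"
  proof (rule ennreal_leI)
    have "(c powr p * (2 * real (m + j))) powr (1 / p) \<le> (c' powr p * (2 * real j)) powr (1 / p)"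
      using j p0 by (intro powr_mono2) auto
    then show "c * (2 * real (m + j)) powr (1 / p) \<le> c' * (2 * real j) powr (1 / p)"
      using c c' p0 by (simp only: powr_mult powr_powr) simp
  qed
  also have "\<dots> = ennreal c' * haar_norm p (exp_box j)"
    using c c' by (simp only: haar_norm_exp_box[OF p0 j(1)]) (intro ennreal_mult, auto)
  also have "\<dots> = haar_norm p (\<lambda>y. ennreal c' * exp_box j y)"
    using c c' p0 by (intro haar_norm_cmult[symmetric] borel_measurable_haar) auto
  also have "\<dots> \<le> haar_norm p (kern_conv \<sigma> ?F)"
  proof (rule haar_norm_mono)
    fix y :: real assume y: "0 < y"
    have "ennreal c' * exp_box j y \<le> (\<integral>\<^sup>+u. kern \<sigma> u * exp_box m u \<partial>haar) * exp_box j y"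
      using m by (intro mult_right_mono) auto
    also have "\<dots> \<le> kern_conv \<sigma> ?F y" by (rule kern_conv_exp_box_ge[OF y])
    finally show "ennreal c' * exp_box j y \<le> kern_conv \<sigma> ?F y" .
  qed (use p in simp)
  finally show False by simp
qed

section \<open>The inequalities with their best constants\<close>

theorem corollary2:
  fixes p q \<sigma> :: real
  assumes "\<sigma> > 1" and "p \<noteq> 0" and "p \<noteq> 1" and "1 / p + 1 / q = 1"
  shows
    "(p > 1 \<longrightarrow>
        ineq_A (<) p q \<sigma> (K_const \<sigma>) \<and>
        ineq_B (<) p \<sigma> (K_const \<sigma>) \<and>
        (ineq_A (<) p q \<sigma> (K_const \<sigma>) \<longleftrightarrow> ineq_B (<) p \<sigma> (K_const \<sigma>)) \<and>
        (\<forall>k < K_const \<sigma>. \<not> ineq_A (<) p q \<sigma> k) \<and>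
        (\<forall>k < K_const \<sigma>. \<not> ineq_B (<) p \<sigma> k)) \<and>
     (0 < p \<and> p < 1 \<or> p < 0 \<longrightarrow>
        ineq_A (>) p q \<sigma> (K_const \<sigma>) \<and>
        ineq_B (>) p \<sigma> (K_const \<sigma>) \<and>
        (ineq_A (>) p q \<sigma> (K_const \<sigma>) \<longleftrightarrow> ineq_B (>) p \<sigma> (K_const \<sigma>)) \<and>
        (\<forall>k > K_const \<sigma>. \<not> ineq_A (>) p q \<sigma> k) \<and>
        (\<forall>k > K_const \<sigma>. \<not> ineq_B (>) p \<sigma> k)) \<and>
     (p > 1 \<longrightarrow>
        ineq_C (<) p q \<sigma> (K_const \<sigma>) \<and>
        ineq_D (<) p \<sigma> (K_const \<sigma>) \<and>
        (ineq_C (<) p q \<sigma> (K_const \<sigma>) \<longleftrightarrow> ineq_D (<) p \<sigma> (K_const \<sigma>)) \<and>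
        (\<forall>k < K_const \<sigma>. \<not> ineq_C (<) p q \<sigma> k) \<and>
        (\<forall>k < K_const \<sigma>. \<not> ineq_D (<) p \<sigma> k)) \<and>
     (0 < p \<and> p < 1 \<or> p < 0 \<longrightarrow>
        ineq_C (>) p q \<sigma> (K_const \<sigma>) \<and>
        ineq_D (>) p \<sigma> (K_const \<sigma>) \<and>
        (ineq_C (>) p q \<sigma> (K_const \<sigma>) \<longleftrightarrow> ineq_D (>) p \<sigma> (K_const \<sigma>)) \<and>
        (adm1 p (phi p \<sigma>) \<noteq> {} \<and> adm1 q (psi q \<sigma>) \<noteq> {} \<longrightarrow>
           (\<forall>k > K_const \<sigma>. \<not> ineq_C (>) p q \<sigma> k)) \<and>
        (0 < p \<or> adm1 p (phi p \<sigma>) \<noteq> {} \<longrightarrow>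
           (\<forall>k > K_const \<sigma>. \<not> ineq_D (>) p \<sigma> k)))"
proof (intro conjI impI)
  note gt = not_ineq_A_gt[OF assms] not_ineq_B_gt[OF assms(1,2)]
  have ac: "\<not> ineq_C (<) p q \<sigma> k \<Longrightarrow> \<not> ineq_A (<) p q \<sigma> k" for k
    using ineq_A_imp_ineq_C[of "(<)"] by blast
  have bd: "\<not> ineq_D R p \<sigma> k \<Longrightarrow> \<not> ineq_B R p \<sigma> k" for R k
    using ineq_B_imp_ineq_D by blast
  {
    assume p: "p > 1"
    show A: "ineq_A (<) p q \<sigma> (K_const \<sigma>)" and B: "ineq_B (<) p \<sigma> (K_const \<sigma>)"
      using ineq_A_K_const(1)[OF assms p] ineq_B_K_const(1)[OF assms(1-3) p] .
    show C: "ineq_C (<) p q \<sigma> (K_const \<sigma>)" and D: "ineq_D (<) p \<sigma> (K_const \<sigma>)"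
      using ineq_A_imp_ineq_C[OF _ A] ineq_B_imp_ineq_D[OF B] by blast+
    show "ineq_A (<) p q \<sigma> (K_const \<sigma>) \<longleftrightarrow> ineq_B (<) p \<sigma> (K_const \<sigma>)"
      "ineq_C (<) p q \<sigma> (K_const \<sigma>) \<longleftrightarrow> ineq_D (<) p \<sigma> (K_const \<sigma>)"
      using A B C D by blast+
    show "\<forall>k<K_const \<sigma>. \<not> ineq_C (<) p q \<sigma> k" "\<forall>k<K_const \<sigma>. \<not> ineq_D (<) p \<sigma> k"
      using not_ineq_C_less[OF assms(1) p assms(4)] not_ineq_D_less[OF assms(1) p] by blast+
    then show "\<forall>k<K_const \<sigma>. \<not> ineq_A (<) p q \<sigma> k" "\<forall>k<K_const \<sigma>. \<not> ineq_B (<) p \<sigma> k"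
      using ac bd by blast+
  next
    assume "0 < p \<and> p < 1 \<or> p < 0"
    then have p: "p < 1" by auto
    show A: "ineq_A (>) p q \<sigma> (K_const \<sigma>)" and B: "ineq_B (>) p \<sigma> (K_const \<sigma>)"
      using ineq_A_K_const(2)[OF assms p] ineq_B_K_const(2)[OF assms(1-3) p] .
    show C: "ineq_C (>) p q \<sigma> (K_const \<sigma>)" and D: "ineq_D (>) p \<sigma> (K_const \<sigma>)"
      using ineq_A_imp_ineq_C[OF _ A] ineq_B_imp_ineq_D[OF B] by blast+
    show "ineq_A (>) p q \<sigma> (K_const \<sigma>) \<longleftrightarrow> ineq_B (>) p \<sigma> (K_const \<sigma>)"
      "ineq_C (>) p q \<sigma> (K_const \<sigma>) \<longleftrightarrow> ineq_D (>) p \<sigma> (K_const \<sigma>)"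
      using A B C D by blast+
    show "\<forall>k>K_const \<sigma>. \<not> ineq_A (>) p q \<sigma> k" "\<forall>k>K_const \<sigma>. \<not> ineq_B (>) p \<sigma> k"
      using gt by blast+
    show "\<forall>k>K_const \<sigma>. \<not> ineq_C (>) p q \<sigma> k"
      if "adm1 p (phi p \<sigma>) \<noteq> {} \<and> adm1 q (psi q \<sigma>) \<noteq> {}"
    proof -
      \<comment> \<open>one exponent is negative, so one of the two sets of admissible functions is empty\<close>
      have "p < 0 \<or> q < 0"
      proof (cases "p < 0")
        case False
        then have "1 < 1 / p" using p assms(2) by simp
        then have "1 / q < 0" using assms(4) by linarith
        then show ?thesis by simp
      qed simp
      then show ?thesis
        using that adm1_phi_empty[OF assms(1)] adm1_psi_empty[OF assms(1)] by blast
    qed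
    show "\<forall>k>K_const \<sigma>. \<not> ineq_D (>) p \<sigma> k" if "0 < p \<or> adm1 p (phi p \<sigma>) \<noteq> {}"
    proof -
      have "0 < p" using that adm1_phi_empty[OF assms(1), of p] assms(2) by (cases "p < 0") auto
      then show ?thesis using not_ineq_D_gt[OF assms(1) _ p] by blast
    qed
  }
qed

end
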